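(* Let $0<\alpha<1$, $T>0$, let $k,m\ge1$ be integers, let $a_1=1$ and $a_2,\dots,a_{k+m}$ be nonzero real numbers, and let $B$ be a constant real $m\times k$ matrix such that $B^{T}B-I_k$ is negative definite. Let $L_j<0$ and $b_j=(L_j,0)$ for $j=1,\dots,k$, and $L_j>0$ and $b_j=(0,L_j)$ for $j=k+1,\dots,k+m$. Given functions $f_j$, $u_{0,j}$, $\varphi_j$ ($j=1,\dots,k+m$) and $\phi_j$ ($j=1,\dots,k$), consider the problem of finding $u_j(x,t)$, $x\in\overline{b_j}$, $0\le t\le T$, $j=1,\dots,k+m$, such that $$ {}_{C}D_{0,t}^{\alpha}u_j(x,t)-\frac{\partial^3}{\partial x^3}u_j(x,t)=f_j(x,t),\quad x\in b_j,\ 0<t\le T,\qquad u_j(x,0)=u_{0,j}(x),\ x\in\overline{b_j},$$ with vertex conditions $$a_ju_j(0,t)=u_1(0,t),\quad j=2,\dots,k+m,$$ $$\frac{\partial u^+}{\partial x}(0,t)=B\,\frac{\partial u^-}{\partial x}(0,t),$$ $$\sum_{j=1}^{k}\frac1{a_j}\frac{\partial^2u_j}{\partial x^2}(0,t)=\sum_{i=k+1}^{k+m}\frac1{a_i}\frac{\partial^2u_i}{\partial x^2}(0,t),$$ and boundary conditions $$u_j(L_j,t)=\varphi_j(t),\ j=1,\dots,k+m,\qquad \frac{\partial u_j}{\partial x}(L_j,t)=\phi_j(t),\ j=1,\dots,k,$$ where $u^-=(u_1,\dots,u_k)^T$ and $u^+=(u_{k+1},\dots,u_{k+m})^T$. Then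 this problem has at most one solution.
   Context: The setting is a star graph with $k$ incoming finite bonds and $m$ outgoing finite bonds meeting at the vertex $x=0$. For $0<\alpha<1$ the Caputo derivative is $${}_{C}D_{0,t}^{\alpha}g(t)=\frac1{\Gamma(1-\alpha)}\int_0^t\frac{g'(\xi)}{(t-\xi)^\alpha}\,d\xi,$$ applied in the variable $t$. A solution is understood in the classical sense: all derivatives and boundary values occurring exist and the equations and conditions hold pointwise. $I_k$ is the $k\times k$ identity matrix.
   Formalization: Solutions are taken classical with continuity: u_j jointly continuous on the closed bond times [0,T], and its first and second x-derivatives and t-derivative jointly continuous where they occur; mere pointwise existence would leave the initial condition decoupled and uniqueness false. *)

theory Defs
  imports "HOL-Analysis.Analysis" "Jordan_Normal_Form.Matrix"
begin

definition neg_definite_mat :: "nat \<Rightarrow> real mat \<Rightarrow> bool" where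
  "neg_definite_mat n A \<longleftrightarrow> A \<in> carrier_mat n n \<and>
     (\<forall>v \<in> carrier_vec n. v \<noteq> 0\<^sub>v n \<longrightarrow> scalar_prod v (A *\<^sub>v v) < 0)"

(* The integral is the Henstock-Kurzweil one, so it covers Lebesgue integrals as well as
   improper ones; the values of the integrand at the two endpoints are irrelevant. *)
definition caputo_integrand :: "real \<Rightarrow> (real \<Rightarrow> real) \<Rightarrow> real \<Rightarrow> real \<Rightarrow> real" where
  "caputo_integrand \<alpha> g t = (\<lambda>\<xi>. deriv g \<xi> / (t - \<xi>) powr \<alpha>)"

definition caputo :: "real \<Rightarrow> (real \<Rightarrow> real) \<Rightarrow> real \<Rightarrow> real" where
  "caputo \<alpha> g t = 1 / Gamma (1 - \<alpha>) * integral {0..t} (caputo_integrand \<alpha> g t)"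

(* Bonds 1, ..., k are incoming (L j < 0), bonds k+1, ..., k+m outgoing (L j > 0). *)
definition bond :: "nat \<Rightarrow> (nat \<Rightarrow> real) \<Rightarrow> nat \<Rightarrow> real set" where
  "bond k L j = (if j \<le> k then {L j<..<0} else {0<..<L j})"

(* Partial derivative in x, relative to S: with S a closed bond this is the ordinary derivative
   inside the bond and the one-sided derivative at its two ends. *)
definition dx :: "real set \<Rightarrow> (real \<Rightarrow> real \<Rightarrow> real) \<Rightarrow> real \<Rightarrow> real \<Rightarrow> real" where
  "dx S w x t = vector_derivative (\<lambda>y. w y t) (at x within S)"

(* Classical regularity on one bond b, where c is its closure. The set r1 collects the points at
   which the first x-derivative occurs in the problem, r2 those at which the second one does
   (in each case including the ends of the bond that carry a condition on that derivative).
   Without joint continuity up to t = 0 the initial condition would not constrain the solution.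
   The third x-derivative is only required to exist, so that f may be an arbitrary function. *)
definition classical_on ::
  "real \<Rightarrow> real \<Rightarrow> real set \<Rightarrow> real set \<Rightarrow> real set \<Rightarrow> real set \<Rightarrow> (real \<Rightarrow> real \<Rightarrow> real) \<Rightarrow> bool" where
  "classical_on \<alpha> T b c r1 r2 w \<longleftrightarrow>
     continuous_on (c \<times> {0..T}) (\<lambda>(x, t). w x t) \<and>
     (\<forall>x\<in>r1. \<forall>t\<in>{0<..T}. (\<lambda>y. w y t) differentiable (at x within c)) \<and>
     continuous_on (r1 \<times> {0<..T}) (\<lambda>(x, t). dx c w x t) \<and>
     (\<forall>x\<in>r2. \<forall>t\<in>{0<..T}. (\<lambda>y. dx c w y t) differentiable (at x within c)) \<and>
     continuous_on (r2 \<times> {0<..T}) (\<lambda>(x, t). dx c (dx c w) x t) \<and>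
     (\<forall>x\<in>b. \<forall>t\<in>{0<..T}. (\<lambda>y. dx c (dx c w) y t) differentiable (at x within c)) \<and>
     (\<forall>x\<in>b. \<forall>t\<in>{0<..<T}. (\<lambda>s. w x s) differentiable (at t)) \<and>
     continuous_on (b \<times> {0<..<T}) (\<lambda>(x, t). deriv (w x) t) \<and>
     (\<forall>x\<in>b. \<forall>t\<in>{0<..T}. caputo_integrand \<alpha> (w x) t integrable_on {0..t})"

(* u j x t is the value on bond j. The data phi0 j and phi1 j are the prescribed values of u j and
   of its x-derivative at L j. JNF vectors are indexed from 0, hence the shifts Suc i. *)
definition star_airy_solution ::
  "real \<Rightarrow> real \<Rightarrow> nat \<Rightarrow> nat \<Rightarrow> (nat \<Rightarrow> real) \<Rightarrow> real mat \<Rightarrow> (nat \<Rightarrow> real) \<Rightarrow>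
   (nat \<Rightarrow> real \<Rightarrow> real \<Rightarrow> real) \<Rightarrow> (nat \<Rightarrow> real \<Rightarrow> real) \<Rightarrow>
   (nat \<Rightarrow> real \<Rightarrow> real) \<Rightarrow> (nat \<Rightarrow> real \<Rightarrow> real) \<Rightarrow>
   (nat \<Rightarrow> real \<Rightarrow> real \<Rightarrow> real) \<Rightarrow> bool" where
  "star_airy_solution \<alpha> T k m a B L f u0 \<phi>0 \<phi>1 u \<longleftrightarrow>
     (let b = bond k L; c = (\<lambda>j. closure (b j));
          ux = (\<lambda>j. dx (c j) (u j)); uxx = (\<lambda>j. dx (c j) (ux j)); uxxx = (\<lambda>j. dx (c j) (uxx j))
      in
       (\<forall>j\<in>{1..k+m}. classical_on \<alpha> T (b j) (c j)
          (if j \<le> k then c j else insert 0 (b j)) (insert 0 (b j)) (u j)) \<and>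
       (\<forall>j\<in>{1..k+m}. \<forall>x\<in>b j. \<forall>t\<in>{0<..T}. caputo \<alpha> (u j x) t - uxxx j x t = f j x t) \<and>
       (\<forall>j\<in>{1..k+m}. \<forall>x\<in>c j. u j x 0 = u0 j x) \<and>
       (\<forall>t\<in>{0<..T}.
          (\<forall>j\<in>{2..k+m}. a j * u j 0 t = u 1 0 t) \<and>
          Matrix.vec m (\<lambda>i. ux (k + Suc i) 0 t) = B *\<^sub>v Matrix.vec k (\<lambda>i. ux (Suc i) 0 t) \<and>
          (\<Sum>j=1..k. 1 / a j * uxx j 0 t) = (\<Sum>i=k+1..k+m. 1 / a i * uxx i 0 t) \<and>
          (\<forall>j\<in>{1..k+m}. u j (L j) t = \<phi>0 j t) \<and>
          (\<forall>j\<in>{1..k}. ux j (L j) t = \<phi>1 j t)))"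

end

theory Submission
  imports Defs
begin

text \<open>
  Only the difference \<open>w\<close> of two solutions matters. Classical regularity gives no control of the
  \<open>x\<close>-derivatives of \<open>w\<close> near \<open>t = 0\<close> and near the far ends of the bonds, so the energy method is not
  applied to \<open>w\<close> itself but to its time primitive \<open>W(x, t) = \<integral>\<^sub>0\<^sup>t w(x, r) dr\<close>. Integrating the equation
  in time turns the Caputo derivative of \<open>w\<close> into a weakly singular convolution: up to a constant,
  \<open>W\<^sub>x\<^sub>x\<^sub>x = K\<close> with \<open>K(x, t) = \<integral>\<^sub>0\<^sup>t w(x, t - s) s\<^sup>-\<^sup>\<alpha> ds\<close>. As \<open>K\<close> is continuous on the closed bond, \<open>W\<close> is
  three times continuously differentiable up to both ends and inherits the homogeneous vertex and
  boundary conditions. Hence \<open>\<integral> W K dx\<close>, summed over the bonds, is a boundary expression that is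
  nonpositive because \<open>B\<^sup>T B - I\<close> is negative definite.

  On the other hand let \<open>t\<^sub>0\<close> maximise \<open>E(t) = \<Sum> \<integral> W(x, t)\<^sup>2 dx\<close>, and put \<open>Q(s) = \<Sum> \<integral> W(x, t\<^sub>0) W(x, s) dx\<close>.
  Then \<open>Q(s) \<le> Q(t\<^sub>0) = E(t\<^sub>0)\<close> for \<open>s \<le> t\<^sub>0\<close>, and an integration by parts in
  \<open>\<Sum> \<integral> W(x, t\<^sub>0) K(x, t\<^sub>0) dx = \<integral>\<^sub>0\<^sup>T Q'(t\<^sub>0 - s) s\<^sup>-\<^sup>\<alpha> ds\<close> bounds it below by a positive multiple of \<open>E(t\<^sub>0)\<close>.
  So \<open>E = 0\<close>.
\<close>

subsection \<open>The weakly singular kernel\<close>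

lemma continuous_on_compose_pair:
  assumes f: "continuous_on (A \<times> B) (\<lambda>(x, t). f x t)"
    and "continuous_on S X" "continuous_on S Y"
    and "\<And>z. z \<in> S \<Longrightarrow> X z \<in> A" "\<And>z. z \<in> S \<Longrightarrow> Y z \<in> B"
  shows "continuous_on S (\<lambda>z. f (X z) (Y z))"
proof -
  have "continuous_on S (\<lambda>z. case (X z, Y z) of (x, t) \<Rightarrow> f x t)"
    using assms(4,5) by (intro continuous_on_compose2[OF f] continuous_on_Pair assms(2,3)) auto
  then show ?thesis
    by simp
qed

lemma integral_swap_interval:
  fixes f :: "real \<Rightarrow> real \<Rightarrow> real"
  assumes "continuous_on ({a..b} \<times> {c..d}) (\<lambda>(x, y). f x y)"
  shows "integral {a..b} (\<lambda>x. integral {c..d} (f x)) = integral {c..d} (\<lambda>y. integral {a..b} (\<lambda>x. f x y))"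
  using integral_swap_continuous[of a c b d f] assms by (simp add: cbox_Pair_eq)

lemma continuous_on_integral_param:
  fixes f :: "'a::topological_space \<Rightarrow> real \<Rightarrow> real"
  assumes "continuous_on (U \<times> {a..b}) (\<lambda>(x, y). f x y)"
  shows "continuous_on U (\<lambda>x. integral {a..b} (f x))"
  using integral_continuous_on_param[of U a b f] assms by simp

lemma has_integral_reflect_shift:
  fixes f :: "real \<Rightarrow> real"
  assumes "(f has_integral I) {t - b..t - a}"
  shows "((\<lambda>s. f (t - s)) has_integral I) {a..b}"
proof -
  have "((\<lambda>x. f (x + t)) has_integral I) {-b..-a}"
    using has_integral_affinity'[of f I "t - b" "t - a" 1 t] assms by simp
  then have "((\<lambda>x. f (-x + t)) has_integral I) {a..b}"
    using has_integral_reflect_real[of "\<lambda>x. f (x + t)" I b a]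
    using has_integral_reflect_real[of "\<lambda>x. f (-x + t)" I b a] by simp
  then show ?thesis
    by (simp add: algebra_simps)
qed

text \<open>With \<open>a > 0\<close> the singularity is out of reach and this is the product rule
  for \<open>F (t - s) * s powr -\<alpha>\<close>. The derivative of \<open>F\<close> is asked for
  in the open interval only, since the time derivative of a solution is not known at time 0.\<close>

lemma kernel_by_parts:
  fixes F f :: "real \<Rightarrow> real"
  assumes "0 < a" "a \<le> b"
    and cont: "continuous_on {t - b..t - a} F"
    and deriv: "\<And>r. r \<in> {t - b<..<t - a} \<Longrightarrow> (F has_real_derivative f r) (at r)"
  shows "((\<lambda>s. f (t - s) * s powr -\<alpha>) has_integral
            (F (t - a) * a powr -\<alpha> - F (t - b) * b powr -\<alpha>
              - \<alpha> * integral {a..b} (\<lambda>s. F (t - s) * s powr (-\<alpha> - 1)))) {a..b}"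
proof -
  have c: "continuous_on {a..b} (\<lambda>s. F (t - s))"
    by (rule continuous_on_compose2[OF cont]) (auto intro!: continuous_intros)
  have cp: "continuous_on {a..b} (\<lambda>s. F (t - s) * s powr e)" for e
    using assms(1) by (intro continuous_on_mult c continuous_on_powr continuous_on_id continuous_on_const) auto
  have d: "((\<lambda>s. - (F (t - s) * s powr -\<alpha>)) has_vector_derivative
      f (t - s) * s powr -\<alpha> + \<alpha> * (F (t - s) * s powr (-\<alpha> - 1))) (at s)" if "s \<in> {a<..<b}" for s
  proof -
    have "(F has_real_derivative f (t - s)) (at (t - s))"
      using that by (intro deriv) auto
    then have "((\<lambda>s. F (t - s)) has_real_derivative f (t - s) * - 1) (at s)"
      by (rule DERIV_chain2) (auto intro!: derivative_eq_intros)
    then have "((\<lambda>s. F (t - s)) has_real_derivative - f (t - s)) (at s)"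
      by simp
    then show ?thesis
      unfolding has_real_derivative_iff_has_vector_derivative[symmetric]
      using that assms(1) by (auto intro!: derivative_eq_intros)
  qed
  have 1: "((\<lambda>s. f (t - s) * s powr -\<alpha> + \<alpha> * (F (t - s) * s powr (-\<alpha> - 1))) has_integral
     - (F (t - b) * b powr -\<alpha>) - - (F (t - a) * a powr -\<alpha>)) {a..b}"
    by (rule fundamental_theorem_of_calculus_interior
        [where f = "\<lambda>s. - (F (t - s) * s powr -\<alpha>)", OF assms(2) continuous_on_minus[OF cp] d])
  have 2: "((\<lambda>s. \<alpha> * (F (t - s) * s powr (-\<alpha> - 1))) has_integral
      \<alpha> * integral {a..b} (\<lambda>s. F (t - s) * s powr (-\<alpha> - 1))) {a..b}"
    by (intro has_integral_mult_right integrable_integral integrable_continuous_interval cp)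
  show ?thesis
    using has_integral_diff[OF 1 2] by simp
qed

text \<open>As -\<alpha> > -1, the nonnegative kernel is absolutely integrable, and a bounded
  measurable factor preserves this.\<close>

lemma integrable_continuous_mult_kernel:
  fixes f :: "real \<Rightarrow> real"
  assumes "\<alpha> < 1" "0 \<le> b" "continuous_on {0..b} f"
  shows "(\<lambda>s. f s * s powr -\<alpha>) integrable_on {0..b}"
proof -
  have "(\<lambda>s. s powr -\<alpha>) absolutely_integrable_on {0..b}"
    using integrable_on_powr_from_0[of "-\<alpha>" b] assms
    by (subst absolutely_integrable_on_iff_nonneg) auto
  then have "(\<lambda>s. f s * s powr -\<alpha>) absolutely_integrable_on {0..b}"
    using assms compact_imp_bounded[OF compact_continuous_image[OF assms(3) compact_Icc]]
    by (intro absolutely_integrable_bounded_measurable_product_real continuous_imp_measurable_on_sets_lebesgue) auto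
  then show ?thesis
    using set_lebesgue_integral_eq_integral(1) by blast
qed

text \<open>The cost of cutting the kernel off at \<open>d\<close>. Integrability is a hypothesis
  because \<open>f\<close> will also be a time derivative, whose product with the kernel is only
  known to be HK integrable.\<close>

lemma kernel_integral_bound:
  fixes f :: "real \<Rightarrow> real"
  assumes "\<alpha> < 1" "0 \<le> d" and int: "(\<lambda>s. f s * s powr -\<alpha>) integrable_on {0..d}"
    and bd: "\<And>s. s \<in> {0..d} \<Longrightarrow> \<bar>f s\<bar> \<le> M"
  shows "\<bar>integral {0..d} (\<lambda>s. f s * s powr -\<alpha>)\<bar> \<le> M * (d powr (1 - \<alpha>) / (1 - \<alpha>))"
proof -
  have I: "((\<lambda>s. M * s powr -\<alpha>) has_integral M * (d powr (1 - \<alpha>) / (1 - \<alpha>))) {0..d}"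
    using has_integral_mult_right[OF has_integral_powr_from_0[of "-\<alpha>" d], of M] assms by simp
  have "norm (integral {0..d} (\<lambda>s. f s * s powr -\<alpha>)) \<le> integral {0..d} (\<lambda>s. M * s powr -\<alpha>)"
    by (rule integral_norm_bound_integral[OF int])
      (use I bd in \<open>auto simp: abs_mult intro!: mult_right_mono\<close>)
  then show ?thesis
    using integral_unique[OF I] by simp
qed

lemma tendsto_kernel_error:
  assumes "\<alpha> < 1"
  shows "((\<lambda>d. C * (d powr (1 - \<alpha>) / (1 - \<alpha>))) \<longlongrightarrow> 0) (at_right (0::real))"
proof -
  have "\<forall>\<^sub>F d in at_right 0. 0 \<le> (d::real)"
    using eventually_at_right_less by eventually_elim auto
  then have "((\<lambda>d. d powr (1 - \<alpha>)) \<longlongrightarrow> 0 powr (1 - \<alpha>)) (at_right (0::real))"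
    using assms by (intro tendsto_powr2 tendsto_ident_at tendsto_const) auto
  from tendsto_mult_left[OF tendsto_divide[OF this tendsto_const], of "1 - \<alpha>" C] show ?thesis
    using assms by simp
qed

subsection \<open>Convolution of a causal function with the kernel\<close>

text \<open>Functions live on all times and vanish up to time 0. Convolutions then run over an
  interval with the fixed end \<open>T\<close>, so theorems on parameter integrals apply.\<close>

locale causal =
  fixes \<alpha> T l h :: real and g :: "real \<Rightarrow> real \<Rightarrow> real"
  assumes \<alpha>_pos: "0 < \<alpha>" and \<alpha>_less_1: "\<alpha> < 1" and T_pos: "0 < T" and l_less_h: "l < h"
    and g_cont: "continuous_on ({l..h} \<times> UNIV) (\<lambda>(x, t). g x t)"
    and g_causal: "\<And>x t. x \<in> {l..h} \<Longrightarrow> t \<le> 0 \<Longrightarrow> g x t = 0"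
begin

definition prim :: "real \<Rightarrow> real \<Rightarrow> real" where
  "prim x t = integral {0..t} (g x)"

text \<open>\<open>d\<close> cuts off the singularity at s = 0. For 0 \<le> t \<le> T the integrand
  vanishes beyond s = t, so \<open>conv 0\<close> is the K of the opening explanation.\<close>

definition conv :: "real \<Rightarrow> real \<Rightarrow> real \<Rightarrow> real" where
  "conv d x t = integral {d..T} (\<lambda>s. g x (t - s) * s powr -\<alpha>)"

text \<open>The time derivative of \<^term>\<open>conv\<close>, integrated by parts so that no derivative of \<^term>\<open>g\<close> occurs.\<close>

definition dconv :: "real \<Rightarrow> real \<Rightarrow> real \<Rightarrow> real" where
  "dconv d x t = g x (t - d) * d powr -\<alpha>
     - \<alpha> * integral {d..T} (\<lambda>s. g x (t - s) * s powr (-\<alpha> - 1))"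

section \<open>Time primitive of a causal function\<close>

lemma continuous_on_g [continuous_intros]:
  assumes "continuous_on S X" "continuous_on S Y" "\<And>z. z \<in> S \<Longrightarrow> X z \<in> {l..h}"
  shows "continuous_on S (\<lambda>z. g (X z) (Y z))"
  using assms by (intro continuous_on_compose_pair[OF g_cont]) auto

text \<open>By causality every base point -c \<le> 0 is as good as 0. For t < 0 both sides are 0,
  the left one because \<open>{0..t}\<close> is empty.\<close>

lemma prim_eq:
  assumes "x \<in> {l..h}" "0 \<le> c" "- c \<le> t"
  shows "prim x t = integral {- c..t} (g x)"
proof (cases "0 \<le> t")
  case True
  have "integral {- c..0} (g x) + integral {0..t} (g x) = integral {- c..t} (g x)"
    using assms True
    by (intro Henstock_Kurzweil_Integration.integral_combine integrable_continuous_interval continuous_intros) auto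
  moreover have "integral {- c..0} (g x) = 0"
    using assms by (intro integral_unique has_integral_is_0) (auto simp: g_causal)
  ultimately show ?thesis
    by (simp add: prim_def)
next
  case False
  then have "integral {- c..t} (g x) = 0"
    using assms by (intro integral_unique has_integral_is_0) (auto simp: g_causal)
  then show ?thesis
    using False by (simp add: prim_def)
qed

lemma prim_nonpos: "x \<in> {l..h} \<Longrightarrow> t \<le> 0 \<Longrightarrow> prim x t = 0"
  by (cases "t = 0") (auto simp: prim_def)

text \<open>Two-sided differentiability also at time 0 and before: with the base point moved to
  \<open>-c\<close>, the time t is interior to [-c, c] and the fundamental theorem applies.\<close>

lemma prim_deriv:
  assumes x: "x \<in> {l..h}"
  shows "(prim x has_real_derivative g x t) (at t)"
proof -
  define c where "c = \<bar>t\<bar> + 1"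
  have t: "t \<in> {-c<..<c}"
    by (auto simp: c_def)
  have "((\<lambda>r. integral {- c..r} (g x)) has_real_derivative g x t) (at t within {-c..c})"
    using t x by (intro integral_has_real_derivative continuous_intros) auto
  then have "((\<lambda>r. integral {- c..r} (g x)) has_real_derivative g x t) (at t within {-c<..<c})"
    by (rule DERIV_subset) auto
  then have "((\<lambda>r. integral {- c..r} (g x)) has_real_derivative g x t) (at t)"
    using t at_within_open[OF t] by simp
  moreover have "integral {- c..r} (g x) = prim x r" if "r \<in> {-c<..<c}" for r
    using prim_eq[of x c r] x that by (auto simp: c_def)
  ultimately show ?thesis
    by (rule has_field_derivative_transform_within_open[OF _ open_greaterThanLessThan t])
qed

text \<open>An integral over a fixed interval, from which joint continuity in x and t can be read
  off.\<close>

lemma prim_reflect: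
  assumes "x \<in> {l..h}" "t \<le> T"
  shows "prim x t = integral {0..T} (\<lambda>s. g x (t - s))"
proof -
  have "(g x has_integral integral {t - T..t} (g x)) {t - T..t - 0}"
    using assms
    by (auto intro!: integrable_integral integrable_continuous_interval continuous_intros)
  from has_integral_reflect_shift[OF this] show ?thesis
    using prim_eq[of x "T - t" t] assms T_pos by (simp add: integral_unique)
qed

lemma prim_continuous: "continuous_on ({l..h} \<times> {..T}) (\<lambda>(x, t). prim x t)"
proof -
  have "continuous_on ({l..h} \<times> {..T}) (\<lambda>z. integral (cbox 0 T) (\<lambda>s. g (fst z) (snd z - s)))"
    by (rule integral_continuous_on_param)
      (auto simp: case_prod_beta intro!: continuous_intros)
  then show ?thesis
    by (rule continuous_on_eq) (auto simp: prim_reflect)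
qed

lemma continuous_on_prim [continuous_intros]:
  assumes "continuous_on S X" "continuous_on S Y"
    "\<And>z. z \<in> S \<Longrightarrow> X z \<in> {l..h}" "\<And>z. z \<in> S \<Longrightarrow> Y z \<le> T"
  shows "continuous_on S (\<lambda>z. prim (X z) (Y z))"
  using assms by (intro continuous_on_compose_pair[OF prim_continuous]) auto

lemma g_bounded:
  obtains M where "0 \<le> M" "\<And>x t. x \<in> {l..h} \<Longrightarrow> t \<le> T \<Longrightarrow> \<bar>g x t\<bar> \<le> M"
proof -
  have "compact ((\<lambda>z. g (fst z) (snd z)) ` ({l..h} \<times> {0..T}))"
    by (intro compact_continuous_image compact_Times compact_Icc continuous_intros) auto
  then obtain M where M: "\<forall>y\<in>(\<lambda>z. g (fst z) (snd z)) ` ({l..h} \<times> {0..T}). norm y \<le> M"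
    using compact_imp_bounded bounded_iff by blast
  have bound: "\<bar>g x t\<bar> \<le> M" if "x \<in> {l..h}" "t \<in> {0..T}" for x t
  proof -
    have "(x, t) \<in> {l..h} \<times> {0..T}"
      using that by (rule SigmaI)
    from bspec[OF M imageI[OF this]] show ?thesis
      by simp
  qed
  have "0 \<le> M"
    using order_trans[OF abs_ge_zero bound[of l 0]] l_less_h T_pos by simp
  moreover have "\<bar>g x t\<bar> \<le> M" if "x \<in> {l..h}" "t \<le> T" for x t
  proof (cases "t \<le> 0")
    case True
    then show ?thesis
      using g_causal[OF that(1)] \<open>0 \<le> M\<close> by simp
  next
    case False
    then show ?thesis
      using that by (intro bound) auto
  qed
  ultimately show ?thesis
    using that by blast
qed

section \<open>The truncated convolution and its uniform limit\<close>

lemma conv_integrable: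
  assumes "x \<in> {l..h}" "0 \<le> b"
  shows "(\<lambda>s. g x (t - s) * s powr -\<alpha>) integrable_on {0..b}"
  using assms \<alpha>_less_1
  by (intro integrable_continuous_mult_kernel) (auto intro!: continuous_intros)

lemma conv_error:
  assumes M: "\<And>x t. x \<in> {l..h} \<Longrightarrow> t \<le> T \<Longrightarrow> \<bar>g x t\<bar> \<le> M"
    and "x \<in> {l..h}" "t \<le> T" "0 \<le> d" "d \<le> T"
  shows "\<bar>conv 0 x t - conv d x t\<bar> \<le> M * (d powr (1 - \<alpha>) / (1 - \<alpha>))"
proof -
  have "conv 0 x t - conv d x t = integral {0..d} (\<lambda>s. g x (t - s) * s powr -\<alpha>)"
    using Henstock_Kurzweil_Integration.integral_combine[OF _ _ conv_integrable[of x T t], of d] assms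
    by (simp add: conv_def)
  then show ?thesis
    using kernel_integral_bound[OF \<alpha>_less_1 assms(4) conv_integrable[OF assms(2,4)], of t M] assms
    by auto
qed

text \<open>Truncating at d = t leaves nothing of the convolution, so the truncation error at d = t
  bounds all of it.\<close>

lemma conv_small:
  assumes M: "\<And>x t. x \<in> {l..h} \<Longrightarrow> t \<le> T \<Longrightarrow> \<bar>g x t\<bar> \<le> M"
    and "x \<in> {l..h}" "0 \<le> t" "t \<le> T"
  shows "\<bar>conv 0 x t\<bar> \<le> M * (t powr (1 - \<alpha>) / (1 - \<alpha>))"
proof -
  have "conv t x t = 0"
    unfolding conv_def using assms
    by (intro integral_unique has_integral_is_0) (auto simp: g_causal)
  then show ?thesis
    using conv_error[of M x t t] assms by auto
qed

lemma continuous_on_kernel_integral [continuous_intros]: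
  assumes "continuous_on S X" "continuous_on S Y" "\<And>z. z \<in> S \<Longrightarrow> X z \<in> {l..h}" "0 < d"
  shows "continuous_on S (\<lambda>z. integral {d..T} (\<lambda>s. g (X z) (Y z - s) * s powr e))"
proof -
  have "continuous_on ({l..h} \<times> UNIV)
      (\<lambda>z. integral (cbox d T) (\<lambda>s. g (fst z) (snd z - s) * s powr e))"
    using assms(4)
    by (intro integral_continuous_on_param) (auto simp: case_prod_beta intro!: continuous_intros)
  then show ?thesis
    using assms by (intro continuous_on_compose_pair[where A = "{l..h}" and B = UNIV and
          f = "\<lambda>x t. integral {d..T} (\<lambda>s. g x (t - s) * s powr e)"])
      (auto simp: case_prod_beta)
qed

lemma conv_continuous_pos:
  assumes "0 < d"
  shows "continuous_on ({l..h} \<times> UNIV) (\<lambda>(x, t). conv d x t)"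
  unfolding conv_def case_prod_beta using assms by (intro continuous_intros) auto

text \<open>The truncations are jointly continuous, and by \<open>conv_error\<close> they converge
  uniformly as d \<rightarrow> 0.\<close>

lemma conv_continuous: "continuous_on ({l..h} \<times> {..T}) (\<lambda>(x, t). conv 0 x t)"
proof (rule uniform_limit_theorem)
  show "\<forall>\<^sub>F d in at_right 0. continuous_on ({l..h} \<times> {..T}) (\<lambda>(x, t). conv d x t)"
    using eventually_at_right_less
    by eventually_elim (auto intro: continuous_on_subset[OF conv_continuous_pos])
  obtain M where M: "0 \<le> M" "\<And>x t. x \<in> {l..h} \<Longrightarrow> t \<le> T \<Longrightarrow> \<bar>g x t\<bar> \<le> M"
    using g_bounded by blast
  show "uniform_limit ({l..h} \<times> {..T}) (\<lambda>d (x, t). conv d x t) (\<lambda>(x, t). conv 0 x t) (at_right 0)"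
  proof (rule uniform_limitI)
    fix e :: real
    assume "0 < e"
    then have "\<forall>\<^sub>F d in at_right 0. M * (d powr (1 - \<alpha>) / (1 - \<alpha>)) < e"
      using tendsto_kernel_error[OF \<alpha>_less_1] by (intro order_tendstoD)
    moreover have "\<forall>\<^sub>F d in at_right 0. d \<in> {0<..<T}"
      using T_pos by (intro eventually_at_rightI[of 0 T]) auto
    ultimately show "\<forall>\<^sub>F d in at_right 0. \<forall>z\<in>{l..h} \<times> {..T}.
        dist (case z of (x, t) \<Rightarrow> conv d x t) (case z of (x, t) \<Rightarrow> conv 0 x t) < e"
    proof eventually_elim
      case (elim d)
      show ?case
      proof
        fix z assume z: "z \<in> {l..h} \<times> {..T}"
        have "\<bar>conv 0 (fst z) (snd z) - conv d (fst z) (snd z)\<bar> \<le> M * (d powr (1 - \<alpha>) / (1 - \<alpha>))"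
          using elim z by (intro conv_error M) auto
        then show "dist (case z of (x, t) \<Rightarrow> conv d x t) (case z of (x, t) \<Rightarrow> conv 0 x t) < e"
          using elim by (simp add: dist_real_def case_prod_beta)
      qed
    qed
  qed
qed simp

lemma continuous_on_conv [continuous_intros]:
  assumes "continuous_on S X" "continuous_on S Y"
    "\<And>z. z \<in> S \<Longrightarrow> X z \<in> {l..h}" "\<And>z. z \<in> S \<Longrightarrow> Y z \<le> T"
  shows "continuous_on S (\<lambda>z. conv 0 (X z) (Y z))"
  using assms by (intro continuous_on_compose_pair[OF conv_continuous]) auto

text \<open>The boundary term at s = T vanishes because t - T \<le> 0.\<close>

lemma conv_by_parts:
  assumes "x \<in> {l..h}" "0 < d" "d \<le> T" "t \<le> T"
  shows "conv d x t = prim x (t - d) * d powr -\<alpha>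
    - \<alpha> * integral {d..T} (\<lambda>s. prim x (t - s) * s powr (-\<alpha> - 1))"
proof -
  have "prim x (t - T) = 0"
    using assms by (intro prim_nonpos) auto
  moreover have "((\<lambda>s. g x (t - s) * s powr -\<alpha>) has_integral
      (prim x (t - d) * d powr -\<alpha> - prim x (t - T) * T powr -\<alpha>
        - \<alpha> * integral {d..T} (\<lambda>s. prim x (t - s) * s powr (-\<alpha> - 1)))) {d..T}"
    using assms by (intro kernel_by_parts prim_deriv continuous_intros) auto
  ultimately show ?thesis
    by (simp add: conv_def integral_unique)
qed

lemma dconv_continuous:
  assumes "0 < d"
  shows "continuous_on ({l..h} \<times> UNIV) (\<lambda>(x, t). dconv d x t)"
  unfolding dconv_def case_prod_beta using assms by (intro continuous_intros) auto

lemma integral_g_shift: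
  assumes "x \<in> {l..h}" "s \<le> t"
  shows "integral {s..t} (\<lambda>r. g x (r - d)) = prim x (t - d) - prim x (s - d)"
proof -
  have "((\<lambda>r. g x (r - d)) has_integral prim x (t - d) - prim x (s - d)) {s..t}"
  proof (rule fundamental_theorem_of_calculus)
    fix r
    have "((\<lambda>r. prim x (r - d)) has_real_derivative g x (r - d) * 1) (at r)"
      by (rule DERIV_chain2[OF prim_deriv[OF assms(1)]]) (auto intro!: derivative_eq_intros)
    then show "((\<lambda>r. prim x (r - d)) has_vector_derivative g x (r - d)) (at r within {s..t})"
      by (simp add: has_real_derivative_iff_has_vector_derivative has_vector_derivative_at_within)
  qed (use assms in auto)
  then show ?thesis
    by (rule integral_unique)
qed

text \<open>Justifies regarding \<open>dconv\<close> as a time derivative without differentiating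
  \<open>conv\<close>: after Fubini the time integral of \<open>dconv\<close> is the difference of
  \<open>conv_by_parts\<close> at the two times.\<close>

lemma integral_dconv:
  assumes x: "x \<in> {l..h}" and d: "0 < d" "d \<le> T" and st: "s \<le> t" "t \<le> T"
  shows "integral {s..t} (dconv d x) = conv d x t - conv d x s"
proof -
  let ?I = "\<lambda>r. integral {d..T} (\<lambda>\<sigma>. g x (r - \<sigma>) * \<sigma> powr (-\<alpha> - 1))"
  have cI: "continuous_on {s..t} ?I"
    using x d by (intro continuous_intros) auto
  have "integral {s..t} ?I = integral {d..T} (\<lambda>\<sigma>. integral {s..t} (\<lambda>r. g x (r - \<sigma>) * \<sigma> powr (-\<alpha> - 1)))"
    unfolding case_prod_beta using x d
    by (intro integral_swap_interval) (auto simp: case_prod_beta intro!: continuous_intros)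
  also have "\<dots> = integral {d..T} (\<lambda>\<sigma>. prim x (t - \<sigma>) * \<sigma> powr (-\<alpha> - 1) - prim x (s - \<sigma>) * \<sigma> powr (-\<alpha> - 1))"
    using integral_g_shift[OF x st(1)] by (simp add: left_diff_distrib)
  also have "\<dots> = integral {d..T} (\<lambda>\<sigma>. prim x (t - \<sigma>) * \<sigma> powr (-\<alpha> - 1))
      - integral {d..T} (\<lambda>\<sigma>. prim x (s - \<sigma>) * \<sigma> powr (-\<alpha> - 1))"
    using x d st by (intro integral_diff integrable_continuous_interval continuous_intros) auto
  finally have I: "integral {s..t} ?I = \<dots>" .
  have "integral {s..t} (dconv d x)
      = integral {s..t} (\<lambda>r. g x (r - d) * d powr -\<alpha>) - integral {s..t} (\<lambda>r. \<alpha> * ?I r)"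
    unfolding dconv_def using x d
    by (intro integral_diff integrable_continuous_interval continuous_intros cI) auto
  also have "\<dots> = (prim x (t - d) - prim x (s - d)) * d powr -\<alpha> - \<alpha> * integral {s..t} ?I"
    using integral_g_shift[OF x st(1)] by simp
  finally show ?thesis
    using conv_by_parts[OF x d, of t] conv_by_parts[OF x d, of s] st I
    by (simp add: algebra_simps)
qed

section \<open>Pairing in x with a fixed function\<close>

lemma pairing_deriv:
  assumes \<phi>: "continuous_on {l..h} \<phi>" and t: "t \<le> T"
  shows "((\<lambda>t. integral {l..h} (\<lambda>x. \<phi> x * prim x t)) has_real_derivative
           integral {l..h} (\<lambda>x. \<phi> x * g x t)) (at t within {..T})"
proof -
  have "((\<lambda>t. integral (cbox l h) (\<lambda>x. \<phi> x * prim x t)) has_field_derivative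
           integral (cbox l h) (\<lambda>x. \<phi> x * g x t)) (at t within {..T})"
  proof (rule leibniz_rule_field_derivative)
    show "continuous_on ({..T} \<times> cbox l h) (\<lambda>(t, x). \<phi> x * g x t)"
      by (auto simp: case_prod_beta intro!: continuous_intros continuous_on_compose2[OF \<phi>])
  next
    fix r x assume "r \<in> {..T}" "x \<in> cbox l h"
    then show "((\<lambda>t. \<phi> x * prim x t) has_real_derivative \<phi> x * g x r) (at r within {..T})"
      by (auto intro!: DERIV_cmult has_field_derivative_at_within[OF prim_deriv])
  qed (use t in \<open>auto intro!: integrable_continuous_interval continuous_intros \<phi>\<close>)
  then show ?thesis
    by simp
qed

lemma pairing_continuous:
  assumes \<phi>: "continuous_on {l..h} \<phi>"
  shows "continuous_on UNIV (\<lambda>t. integral {l..h} (\<lambda>x. \<phi> x * g x t))"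
  by (intro continuous_on_integral_param)
    (auto simp: case_prod_beta intro!: continuous_intros continuous_on_compose2[OF \<phi>])

text \<open>For d > 0 the kernel is continuous and Fubini turns the left side into the pairing with
  \<open>conv d\<close>. Passing to \<open>conv 0\<close> costs the bound of \<phi> times
  \<open>conv_error\<close> times the length of the bond, which gives the constant independent of
  d.\<close>

lemma pairing_conv:
  assumes \<phi>: "continuous_on {l..h} \<phi>" and t: "t \<le> T"
  shows "\<exists>C. \<forall>d\<in>{0<..T}.
      integral {d..T} (\<lambda>s. integral {l..h} (\<lambda>x. \<phi> x * g x (t - s)) * s powr -\<alpha>)
        \<le> integral {l..h} (\<lambda>x. \<phi> x * conv 0 x t) + C * (d powr (1 - \<alpha>) / (1 - \<alpha>))"
proof -
  obtain M where M: "0 \<le> M" "\<And>x t. x \<in> {l..h} \<Longrightarrow> t \<le> T \<Longrightarrow> \<bar>g x t\<bar> \<le> M"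
    using g_bounded by blast
  have "bounded (\<phi> ` {l..h})"
    by (intro compact_imp_bounded compact_continuous_image \<phi> compact_Icc)
  then obtain N where "\<forall>y\<in>\<phi> ` {l..h}. norm y \<le> N"
    unfolding bounded_iff by blast
  then have N: "\<bar>\<phi> x\<bar> \<le> N" if "x \<in> {l..h}" for x
    using that by simp
  have "0 \<le> N"
    using N[of l] l_less_h by force
  show ?thesis
  proof (intro exI[of _ "N * M * (h - l)"] ballI)
    fix d assume "d \<in> {0<..T}"
    then have d: "0 < d" "d \<le> T"
      by auto
    let ?\<epsilon> = "d powr (1 - \<alpha>) / (1 - \<alpha>)"
    have c: "continuous_on {l..h} (\<lambda>x. conv d x t)"
      by (intro continuous_on_compose_pair[OF conv_continuous_pos[OF d(1)]] continuous_intros) auto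
    have "integral {d..T} (\<lambda>s. integral {l..h} (\<lambda>x. \<phi> x * g x (t - s)) * s powr -\<alpha>)
        = integral {d..T} (\<lambda>s. integral {l..h} (\<lambda>x. \<phi> x * (g x (t - s) * s powr -\<alpha>)))"
      by (simp add: mult.assoc flip: integral_mult_left)
    also have "\<dots> = integral {l..h} (\<lambda>x. integral {d..T} (\<lambda>s. \<phi> x * (g x (t - s) * s powr -\<alpha>)))"
      using d by (intro integral_swap_interval)
        (auto simp: case_prod_beta intro!: continuous_intros continuous_on_compose2[OF \<phi>])
    also have "\<dots> = integral {l..h} (\<lambda>x. \<phi> x * conv d x t)"
      by (simp add: conv_def)
    also have "\<dots> \<le> integral {l..h} (\<lambda>x. \<phi> x * conv 0 x t + N * (M * ?\<epsilon>))"
    proof (rule integral_le)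
      fix x assume x: "x \<in> {l..h}"
      have "\<phi> x * conv d x t - \<phi> x * conv 0 x t \<le> \<bar>\<phi> x\<bar> * \<bar>conv 0 x t - conv d x t\<bar>"
        by (metis abs_ge_self abs_minus_commute abs_mult right_diff_distrib)
      also have "\<dots> \<le> N * (M * ?\<epsilon>)"
        using conv_error[OF M(2) x t, of d] N[OF x] d \<open>0 \<le> N\<close> by (intro mult_mono) auto
      finally show "\<phi> x * conv d x t \<le> \<phi> x * conv 0 x t + N * (M * ?\<epsilon>)"
        by simp
    qed (use t in \<open>auto intro!: integrable_continuous_interval continuous_intros \<phi> c\<close>)
    also have "\<dots> = integral {l..h} (\<lambda>x. \<phi> x * conv 0 x t) + (N * M * (h - l)) * ?\<epsilon>"
      using t l_less_h
      by (subst integral_add) (auto intro!: integrable_continuous_interval continuous_intros \<phi>)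
    finally show "integral {d..T} (\<lambda>s. integral {l..h} (\<lambda>x. \<phi> x * g x (t - s)) * s powr -\<alpha>)
        \<le> integral {l..h} (\<lambda>x. \<phi> x * conv 0 x t) + (N * M * (h - l)) * ?\<epsilon>" .
  qed
qed

end

subsection \<open>Regularity of the time primitive on one bond\<close>

lemma continuous_on_eq_on_dense:
  fixes f g :: "'a::topological_space \<Rightarrow> real"
  assumes "continuous_on R f" "continuous_on R g" "S \<subseteq> R" "R \<subseteq> closure S"
    and eq: "\<And>x. x \<in> S \<Longrightarrow> f x = g x" and "x \<in> R"
  shows "f x = g x"
proof -
  have "closedin (top_of_set R) {x \<in> R. f x - g x = 0}"
    by (intro continuous_closedin_preimage_constant continuous_on_diff assms)
  then obtain K where K: "closed K" "{x \<in> R. f x - g x = 0} = R \<inter> K"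
    unfolding closedin_closed by blast
  have "S \<subseteq> K"
    using K(2) assms(3) eq by auto
  then have "closure S \<subseteq> K"
    using K(1) by (rule closure_minimal)
  then show ?thesis
    using K(2) assms(4,6) by auto
qed

lemma same_derivative_imp_eq:
  fixes f g :: "real \<Rightarrow> real"
  assumes "convex U" "a \<in> U" "f a = g a"
    and f: "\<And>x. x \<in> U \<Longrightarrow> (f has_real_derivative f' x) (at x within U)"
    and g: "\<And>x. x \<in> U \<Longrightarrow> (g has_real_derivative f' x) (at x within U)"
    and "x \<in> U"
  shows "f x = g x"
proof -
  have "((\<lambda>x. f x - g x) has_real_derivative 0) (at x within U)" if "x \<in> U" for x
    using DERIV_diff[OF f g, OF that that] by simp
  then obtain c where "\<forall>x\<in>U. f x - g x = c"
    using has_field_derivative_zero_constant[OF assms(1)] by blast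
  then have "f a - g a = c" "f x - g x = c"
    using assms(2,6) by blast+
  then show ?thesis
    using assms(3) by simp
qed

text \<open>The primitive vanishing at \<open>0\<close>; the base point \<open>l\<close> makes it uniform in the sign of \<open>x\<close>.\<close>

definition antideriv :: "real \<Rightarrow> (real \<Rightarrow> real) \<Rightarrow> real \<Rightarrow> real" where
  "antideriv l f x = integral {l..x} f - integral {l..0} f"

lemma antideriv_0 [simp]: "antideriv l f 0 = 0"
  by (simp add: antideriv_def)

lemma antideriv_deriv:
  assumes "continuous_on {l..h} f" "x \<in> {l..h}"
  shows "(antideriv l f has_real_derivative f x) (at x within {l..h})"
  unfolding antideriv_def
  using DERIV_diff[OF integral_has_real_derivative[OF assms] DERIV_const] by simp

lemma antideriv_continuous: "continuous_on {l..h} f \<Longrightarrow> continuous_on {l..h} (antideriv l f)"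
  by (rule DERIV_continuous_on) (rule antideriv_deriv)

lemma antideriv_diff:
  assumes "continuous_on {l..h} f" "continuous_on {l..h} g" "x \<in> {l..h}" "0 \<in> {l..h}"
  shows "antideriv l (\<lambda>x. f x - g x) x = antideriv l f x - antideriv l g x"
proof -
  have "integral {l..y} (\<lambda>x. f x - g x) = integral {l..y} f - integral {l..y} g" if "y \<in> {l..h}" for y
    using that by (intro integral_diff integrable_continuous_interval)
      (auto intro: continuous_on_subset assms(1,2))
  then show ?thesis
    using assms(3,4) by (simp add: antideriv_def)
qed

lemma antideriv_bound:
  assumes f: "continuous_on {l..h} f" and bd: "\<And>x. x \<in> {l..h} \<Longrightarrow> \<bar>f x\<bar> \<le> B"
    and "x \<in> {l..h}" "0 \<in> {l..h}"
  shows "\<bar>antideriv l f x\<bar> \<le> 2 * ((h - l) * B)"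
proof -
  have "0 \<le> B"
    using bd[of 0] assms(4) by force
  have "\<bar>integral {l..y} f\<bar> \<le> (h - l) * B" if y: "y \<in> {l..h}" for y
  proof -
    have "norm (integral {l..y} f) \<le> B * (y - l)"
      using y bd by (intro integral_bound continuous_on_subset[OF f]) auto
    also have "\<dots> \<le> B * (h - l)"
      using y \<open>0 \<le> B\<close> by (intro mult_left_mono) auto
    finally show ?thesis
      by (simp add: mult.commute)
  qed
  from this[of x] this[of 0] show ?thesis
    using assms(3,4) unfolding antideriv_def by linarith
qed

text \<open>What is known of the difference of two solutions on one bond: nothing on x-derivatives
  at time 0, two of them up to the vertex, the first also on \<open>R\<close>, the third in the open
  bond without continuity. One end is the vertex, so incoming and outgoing bonds are treated
  alike.\<close>

locale airy_bond = causal \<alpha> T l h g for \<alpha> T l h :: real and g :: "real \<Rightarrow> real \<Rightarrow> real" +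
  fixes c :: real and w1 w2 wt :: "real \<Rightarrow> real \<Rightarrow> real" and R :: "real set"
  assumes vertex: "l = 0 \<or> h = 0"
    and R: "insert 0 {l<..<h} \<subseteq> R" "R \<subseteq> {l..h}"
    and g_dx: "\<And>x t. x \<in> insert 0 {l<..<h} \<Longrightarrow> t \<in> {0<..<T} \<Longrightarrow>
      ((\<lambda>y. g y t) has_real_derivative w1 x t) (at x within {l..h})"
    and w1_cont: "continuous_on (R \<times> {0<..<T}) (\<lambda>(x, t). w1 x t)"
    and w1_dx: "\<And>x t. x \<in> insert 0 {l<..<h} \<Longrightarrow> t \<in> {0<..<T} \<Longrightarrow>
      ((\<lambda>y. w1 y t) has_real_derivative w2 x t) (at x within {l..h})"
    and w2_cont: "continuous_on (insert 0 {l<..<h} \<times> {0<..<T}) (\<lambda>(x, t). w2 x t)"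
    and g_dt: "\<And>x t. x \<in> {l<..<h} \<Longrightarrow> t \<in> {0<..<T} \<Longrightarrow>
      (g x has_real_derivative wt x t) (at t)"
    and wt_cont: "continuous_on ({l<..<h} \<times> {0<..<T}) (\<lambda>(x, t). wt x t)"
    and caputo_integrable: "\<And>x t. x \<in> {l<..<h} \<Longrightarrow> t \<in> {0<..<T} \<Longrightarrow>
      (\<lambda>r. wt x r * (t - r) powr -\<alpha>) integrable_on {0..t}"
    and w2_dx: "\<And>x t. x \<in> {l<..<h} \<Longrightarrow> t \<in> {0<..<T} \<Longrightarrow>
      ((\<lambda>y. w2 y t) has_real_derivative c * integral {0..t} (\<lambda>r. wt x r * (t - r) powr -\<alpha>)) (at x)"
begin

abbreviation "U \<equiv> insert 0 {l<..<h}"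

lemma U_eq: "U = (if l = 0 then {0..<h} else {l<..0})"
  using vertex l_less_h by auto

lemma U_convex: "convex U"
  by (simp add: U_eq)

lemma U_subset: "U \<subseteq> {l..h}" and zero_in: "0 \<in> {l..h}"
  using vertex l_less_h by auto

section \<open>The truncated Caputo derivative\<close>

lemma caputo_reflect:
  assumes "x \<in> {l<..<h}" "t \<in> {0<..<T}"
  shows "((\<lambda>s. wt x (t - s) * s powr -\<alpha>) has_integral
     integral {0..t} (\<lambda>r. wt x r * (t - r) powr -\<alpha>)) {0..t}"
  using has_integral_reflect_shift[of "\<lambda>r. wt x r * (t - r) powr -\<alpha>" _ t t 0]
    integrable_integral[OF caputo_integrable[OF assms]]
  by simp

text \<open>Integration by parts down to time 0: the boundary term there vanishes since g starts
  from 0, and causality extends the remaining integral from t to T.\<close>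

lemma truncated_caputo:
  assumes x: "x \<in> {l<..<h}" and t: "t \<in> {0<..<T}" and d: "0 < d" "d \<le> t"
  shows "integral {d..t} (\<lambda>s. wt x (t - s) * s powr -\<alpha>) = dconv d x t"
proof -
  have by_parts: "((\<lambda>s. wt x (t - s) * s powr -\<alpha>) has_integral
      (g x (t - d) * d powr -\<alpha> - g x (t - t) * t powr -\<alpha>
        - \<alpha> * integral {d..t} (\<lambda>s. g x (t - s) * s powr (-\<alpha> - 1)))) {d..t}"
    using x t d by (intro kernel_by_parts g_dt continuous_intros) auto
  have "integral {d..t} (\<lambda>s. g x (t - s) * s powr (-\<alpha> - 1))
      + integral {t..T} (\<lambda>s. g x (t - s) * s powr (-\<alpha> - 1))
      = integral {d..T} (\<lambda>s. g x (t - s) * s powr (-\<alpha> - 1))"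
    using x t d by (intro Henstock_Kurzweil_Integration.integral_combine integrable_continuous_interval
        continuous_intros) auto
  moreover have "integral {t..T} (\<lambda>s. g x (t - s) * s powr (-\<alpha> - 1)) = 0"
    using x by (intro integral_unique has_integral_is_0) (auto simp: g_causal)
  moreover have "g x 0 = 0"
    using x by (intro g_causal) auto
  ultimately show ?thesis
    using integral_unique[OF by_parts] by (simp add: dconv_def)
qed

text \<open>The two sides differ only by the integral over the last stretch of length d before time
  t, so a bound for \<open>wt\<close> on that stretch suffices.\<close>

lemma caputo_error:
  assumes x: "x \<in> {l<..<h}" and t: "t \<in> {0<..<T}" and d: "0 < d" "d \<le> t"
    and M: "\<And>r. r \<in> {t - d..t} \<Longrightarrow> \<bar>wt x r\<bar> \<le> M"
  shows "\<bar>integral {0..t} (\<lambda>r. wt x r * (t - r) powr -\<alpha>) - dconv d x t\<bar>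
     \<le> M * (d powr (1 - \<alpha>) / (1 - \<alpha>))"
proof -
  let ?f = "\<lambda>s. wt x (t - s) * s powr -\<alpha>"
  have int: "?f integrable_on {0..t}"
    using caputo_reflect[OF x t] by (rule has_integral_integrable)
  have "integral {0..t} (\<lambda>r. wt x r * (t - r) powr -\<alpha>) - dconv d x t = integral {0..d} ?f"
    using Henstock_Kurzweil_Integration.integral_combine[OF _ _ int, of d] d
      integral_unique[OF caputo_reflect[OF x t]] truncated_caputo[OF x t d] by simp
  moreover have "?f integrable_on {0..d}"
    using d by (intro integrable_on_subinterval[OF int]) auto
  ultimately show ?thesis
    using kernel_integral_bound[of \<alpha> d "\<lambda>s. wt x (t - s)" M] M d \<alpha>_less_1 by simp
qed

text \<open>
  The Caputo derivative is only known to be an HK integral for each \<open>x\<close>, so the order of integration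
  is exchanged for the truncations at distance \<open>d\<close> from the singularity, which are continuous. They
  converge uniformly because \<^term>\<open>wt\<close> is bounded near the singularity, away from \<open>t = 0\<close>.
\<close>

lemma w2_interior:
  assumes pq: "p \<in> {l<..<h}" "q \<in> {l<..<h}" "p \<le> q" and st: "0 < s" "s \<le> t" "t < T"
  shows "integral {s..t} (w2 q) - integral {s..t} (w2 p)
    = c * integral {p..q} (\<lambda>x. conv 0 x t - conv 0 x s)"
proof -
  let ?\<kappa> = "\<lambda>d. d powr (1 - \<alpha>) / (1 - \<alpha>)"
  let ?cap = "\<lambda>x r. integral {0..r} (\<lambda>\<sigma>. wt x \<sigma> * (r - \<sigma>) powr -\<alpha>)"
  have sub: "x \<in> {l<..<h}" "x \<in> {l..h}" if "x \<in> {p..q}" for x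
    using that pq by auto
  \<comment> \<open>For times r \<ge> s and d \<le> s / 2, the stretch [r - d, r] stays in
    [s / 2, t], so one compact set supplies the bound for all the errors.\<close>
  have "compact ((\<lambda>z. wt (fst z) (snd z)) ` ({p..q} \<times> {s / 2..t}))"
    using pq st
    by (intro compact_continuous_image compact_Times compact_Icc continuous_on_compose_pair[OF wt_cont] continuous_intros) auto
  then obtain M where "\<forall>y\<in>(\<lambda>z. wt (fst z) (snd z)) ` ({p..q} \<times> {s / 2..t}). norm y \<le> M"
    using compact_imp_bounded bounded_iff by blast
  then have M: "\<bar>wt x r\<bar> \<le> M" if "x \<in> {p..q}" "r \<in> {s / 2..t}" for x r
    using that by force
  obtain N where N: "0 \<le> N" "\<And>x t. x \<in> {l..h} \<Longrightarrow> t \<le> T \<Longrightarrow> \<bar>g x t\<bar> \<le> N"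
    using g_bounded by blast
  have triangle: "\<bar>x - y\<bar> \<le> e \<Longrightarrow> \<bar>y - z\<bar> \<le> e' \<Longrightarrow> \<bar>x - z\<bar> \<le> e + e'" for x y z e e' :: real
    by linarith
  let ?D = "\<lambda>r. w2 q r - w2 p r"
  let ?X = "integral {p..q} (\<lambda>x. conv 0 x t - conv 0 x s)"
  have cw2: "continuous_on {s..t} (w2 y)" if "y \<in> {l<..<h}" for y
    using that st by (intro continuous_on_compose_pair[OF w2_cont] continuous_intros) auto
  have D: "integral {s..t} (w2 q) - integral {s..t} (w2 p) = integral {s..t} ?D"
    using pq by (intro integral_diff[symmetric] integrable_continuous_interval cw2) auto
  \<comment> \<open>The first summand pays for replacing the Caputo integral by
    \<open>dconv\<close>, integrated over time and space; the second for replacing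
    \<open>conv d\<close> by \<open>conv 0\<close> at both times, hence the factor 2.\<close>
  define E where "E d = (t - s) * ((q - p) * (\<bar>c\<bar> * (M * ?\<kappa> d))) + \<bar>c\<bar> * ((q - p) * (2 * (N * ?\<kappa> d)))" for d
  have main: "\<bar>integral {s..t} ?D - c * ?X\<bar> \<le> E d" if d: "0 < d" "d \<le> s / 2" for d
  proof -
    have dT: "d \<le> T"
      using d st by linarith
    have cd: "continuous_on S (\<lambda>z. dconv d (X z) (Y z))"
      if "continuous_on S X" "continuous_on S Y" "\<And>z. z \<in> S \<Longrightarrow> X z \<in> {p..q}" for S and X Y :: "'z::topological_space \<Rightarrow> real"
      using that sub(2) by (intro continuous_on_compose_pair[OF dconv_continuous[OF d(1)]]) auto
    have A: "\<bar>?D r - c * integral {p..q} (\<lambda>x. dconv d x r)\<bar> \<le> (q - p) * (\<bar>c\<bar> * (M * ?\<kappa> d))"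
      if r: "r \<in> {s..t}" for r
    proof -
      \<comment> \<open>For the HK integral every derivative is integrable, so the Caputo term can
        be integrated in x although nothing is known about its dependence on x.\<close>
      have "((\<lambda>x. c * ?cap x r) has_integral ?D r) {p..q}"
      proof (rule fundamental_theorem_of_calculus[where f = "\<lambda>x. w2 x r"])
        fix x assume "x \<in> {p..q}"
        then have "((\<lambda>y. w2 y r) has_real_derivative c * ?cap x r) (at x)"
          using r st sub(1) by (intro w2_dx) auto
        then show "((\<lambda>y. w2 y r) has_vector_derivative c * ?cap x r) (at x within {p..q})"
          by (simp add: has_real_derivative_iff_has_vector_derivative has_vector_derivative_at_within)
      qed (use pq in auto)
      moreover have "((\<lambda>x. c * dconv d x r) has_integral c * integral {p..q} (\<lambda>x. dconv d x r)) {p..q}"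
        by (intro has_integral_mult_right integrable_integral integrable_continuous_interval cd) auto
      ultimately have I: "((\<lambda>x. c * ?cap x r - c * dconv d x r) has_integral
          ?D r - c * integral {p..q} (\<lambda>x. dconv d x r)) {p..q}"
        by (rule has_integral_diff)
      have bd: "norm (c * ?cap x r - c * dconv d x r) \<le> \<bar>c\<bar> * (M * ?\<kappa> d)" if x: "x \<in> {p..q}" for x
      proof -
        have "\<bar>?cap x r - dconv d x r\<bar> \<le> M * ?\<kappa> d"
          using sub(1)[OF x] r st d x by (intro caputo_error M) auto
        from mult_left_mono[OF this abs_ge_zero[of c]] show ?thesis
          by (simp add: abs_mult flip: right_diff_distrib)
      qed
      have "0 \<le> \<bar>c\<bar> * (M * ?\<kappa> d)"
        using order_trans[OF norm_ge_zero bd[of p]] pq by simp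
      then have "norm (?D r - c * integral {p..q} (\<lambda>x. dconv d x r))
          \<le> \<bar>c\<bar> * (M * ?\<kappa> d) * Henstock_Kurzweil_Integration.content {p..q}"
        by (rule has_integral_bound_real[OF _ finite.emptyI I]) (use bd in auto)
      then show ?thesis
        using pq by (simp add: mult_ac)
    qed
    have B: "integral {s..t} (\<lambda>r. integral {p..q} (\<lambda>x. dconv d x r))
        = integral {p..q} (\<lambda>x. conv d x t - conv d x s)"
    proof -
      have "integral {s..t} (\<lambda>r. integral {p..q} (\<lambda>x. dconv d x r))
          = integral {p..q} (\<lambda>x. integral {s..t} (\<lambda>r. dconv d x r))"
        by (intro integral_swap_interval) (auto simp: case_prod_beta intro!: cd continuous_intros)
      also have "\<dots> = integral {p..q} (\<lambda>x. conv d x t - conv d x s)"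
        using sub(2) d dT st by (intro integral_cong integral_dconv) auto
      finally show ?thesis .
    qed
    have cI: "continuous_on {s..t} (\<lambda>r. integral {p..q} (\<lambda>x. dconv d x r))"
      by (intro continuous_on_integral_param) (auto simp: case_prod_beta intro!: cd continuous_intros)
    have cD: "continuous_on {s..t} ?D"
      by (intro continuous_on_diff cw2 pq)
    have ccI: "continuous_on {s..t} (\<lambda>r. c * integral {p..q} (\<lambda>x. dconv d x r))"
      by (intro continuous_on_mult continuous_on_const cI)
    have "integral {s..t} ?D - c * integral {s..t} (\<lambda>r. integral {p..q} (\<lambda>x. dconv d x r))
        = integral {s..t} (\<lambda>r. ?D r - c * integral {p..q} (\<lambda>x. dconv d x r))"
      using integral_diff[OF integrable_continuous_interval[OF cD] integrable_continuous_interval[OF ccI]]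
      by (simp only: integral_mult_right)
    also have "norm \<dots> \<le> ((q - p) * (\<bar>c\<bar> * (M * ?\<kappa> d))) * (t - s)"
      using A by (intro integral_bound[OF st(2) continuous_on_diff[OF cD ccI]]) (simp only: real_norm_def)
    finally have C1: "\<bar>integral {s..t} ?D - c * integral {p..q} (\<lambda>x. conv d x t - conv d x s)\<bar>
        \<le> (t - s) * ((q - p) * (\<bar>c\<bar> * (M * ?\<kappa> d)))"
      unfolding B by (simp only: real_norm_def mult.commute)
    let ?H = "\<lambda>x. (conv d x t - conv d x s) - (conv 0 x t - conv 0 x s)"
    have cc: "continuous_on {p..q} (\<lambda>x. conv d x r)" for r
      using sub(2) by (intro continuous_on_compose_pair[OF conv_continuous_pos[OF d(1)]] continuous_intros) auto
    have c0: "continuous_on {p..q} (\<lambda>x. conv 0 x r)" if "r \<le> T" for r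
      using sub(2) that by (intro continuous_intros) auto
    have H: "\<bar>?H x\<bar> \<le> 2 * (N * ?\<kappa> d)" if "x \<in> {p..q}" for x
      using conv_error[OF N(2), of x t d] conv_error[OF N(2), of x s d] sub(2)[OF that] d dT st by auto
    have cd: "continuous_on {p..q} (\<lambda>x. conv d x t - conv d x s)"
      by (intro continuous_on_diff cc)
    have c00: "continuous_on {p..q} (\<lambda>x. conv 0 x t - conv 0 x s)"
      using st by (intro continuous_on_diff c0) auto
    have "norm (integral {p..q} ?H) \<le> 2 * (N * ?\<kappa> d) * (q - p)"
      using H by (intro integral_bound[OF pq(3) continuous_on_diff[OF cd c00]]) (simp only: real_norm_def)
    moreover have "integral {p..q} ?H = integral {p..q} (\<lambda>x. conv d x t - conv d x s) - ?X"
      by (rule integral_diff[OF integrable_continuous_interval[OF cd] integrable_continuous_interval[OF c00]])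
    ultimately have "\<bar>integral {p..q} (\<lambda>x. conv d x t - conv d x s) - ?X\<bar>
        \<le> (q - p) * (2 * (N * ?\<kappa> d))"
      by (simp add: mult.commute)
    from mult_left_mono[OF this abs_ge_zero[of c]]
    have "\<bar>c * integral {p..q} (\<lambda>x. conv d x t - conv d x s) - c * ?X\<bar>
        \<le> \<bar>c\<bar> * ((q - p) * (2 * (N * ?\<kappa> d)))"
      by (simp only: abs_mult flip: right_diff_distrib)
    then show ?thesis
      unfolding E_def by (rule triangle[OF C1])
  qed
  \<comment> \<open>The error is a constant multiple of \<open>?\<kappa> d\<close>, while the
    quantity it bounds does not depend on d.\<close>
  have "((\<lambda>d. ((t - s) * (q - p) * \<bar>c\<bar> * M + \<bar>c\<bar> * (q - p) * 2 * N) * ?\<kappa> d) \<longlongrightarrow> 0) (at_right 0)"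
    by (rule tendsto_kernel_error[OF \<alpha>_less_1])
  moreover have "((t - s) * (q - p) * \<bar>c\<bar> * M + \<bar>c\<bar> * (q - p) * 2 * N) * y
      = (t - s) * ((q - p) * (\<bar>c\<bar> * (M * y))) + \<bar>c\<bar> * ((q - p) * (2 * (N * y)))" for y
    by (simp add: algebra_simps)
  ultimately have "(E \<longlongrightarrow> 0) (at_right 0)"
    by (simp only: E_def[abs_def])
  moreover have "\<forall>\<^sub>F d in at_right 0. \<bar>integral {s..t} ?D - c * ?X\<bar> \<le> E d"
    using main st by (intro eventually_at_rightI[of 0 "s / 2"]) auto
  ultimately have "\<bar>integral {s..t} ?D - c * ?X\<bar> \<le> 0"
    by (intro tendsto_lowerbound) auto
  then show ?thesis
    using D by simp
qed

section \<open>Taylor formula at the vertex for integrals over [s, t]\<close>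

lemma R_closure: "R \<subseteq> closure {l<..<h}"
  using R(2) l_less_h by (simp add: closure_greaterThanLessThan)

lemma U_closure: "U \<subseteq> closure {l<..<h}"
  using U_subset l_less_h by (simp add: closure_greaterThanLessThan)

text \<open>Integrating from a time s > 0 avoids time 0, where the x-derivatives are uncontrolled.
  By \<open>w2_interior\<close>, \<open>k s t\<close> is the x-derivative of \<open>I2 s t\<close>
  in the open bond.\<close>

abbreviation "I0 s t x \<equiv> integral {s..t} (g x)"
abbreviation "I1 s t x \<equiv> integral {s..t} (w1 x)"
abbreviation "I2 s t x \<equiv> integral {s..t} (w2 x)"
abbreviation "k s t x \<equiv> c * conv 0 x t - c * conv 0 x s"

lemma conv_x_continuous: "t \<le> T \<Longrightarrow> continuous_on {l..h} (\<lambda>x. c * conv 0 x t)"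
  by (auto intro!: continuous_intros)

lemma k_continuous: "s \<le> T \<Longrightarrow> t \<le> T \<Longrightarrow> continuous_on {l..h} (k s t)"
  by (auto intro!: continuous_intros)

text \<open>By \<open>w2_interior\<close> the difference of \<open>I2\<close> and the antiderivative
  is constant on the open bond. Continuity carries this to the vertex, where the antiderivative is
  0.\<close>

lemma I2_eq:
  assumes st: "0 < s" "s \<le> t" "t < T" and x: "x \<in> U"
  shows "I2 s t x = I2 s t 0 + antideriv l (k s t) x"
proof -
  let ?f = "\<lambda>x. I2 s t x - antideriv l (k s t) x"
  have ck: "continuous_on {l..h} (k s t)"
    using st by (intro k_continuous) auto
  have step: "?f p = ?f q" if pq: "p \<in> {l<..<h}" "q \<in> {l<..<h}" "p \<le> q" for p q
  proof -
    have "integral {l..p} (k s t) + integral {p..q} (k s t) = integral {l..q} (k s t)"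
      using pq by (intro Henstock_Kurzweil_Integration.integral_combine integrable_continuous_interval
          continuous_on_subset[OF ck]) auto
    moreover have "integral {p..q} (k s t) = c * integral {p..q} (\<lambda>x. conv 0 x t - conv 0 x s)"
      by (simp flip: right_diff_distrib)
    ultimately show ?thesis
      using w2_interior[OF pq st] by (simp add: antideriv_def)
  qed
  obtain m where m: "m \<in> {l<..<h}"
    using dense[OF l_less_h] by auto
  have const: "?f y = ?f m" if y: "y \<in> {l<..<h}" for y
  proof (cases "y \<le> m")
    case True
    then show ?thesis
      by (rule step[OF y m])
  next
    case False
    then show ?thesis
      by (intro step[OF m y, symmetric]) simp
  qed
  have "continuous_on (U \<times> {s..t}) (\<lambda>(x, r). w2 x r)"
    using st by (intro continuous_on_subset[OF w2_cont]) auto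
  then have "continuous_on U (I2 s t)"
    by (rule continuous_on_integral_param)
  then have cf: "continuous_on U ?f"
    by (intro continuous_on_diff continuous_on_subset[OF antideriv_continuous[OF ck] U_subset])
  have "?f y = ?f m" if "y \<in> U" for y
    by (rule continuous_on_eq_on_dense[OF cf continuous_on_const _ U_closure const that]) auto
  from this[OF x] this[of 0] show ?thesis
    by simp
qed

lemma I1_deriv:
  assumes st: "0 < s" "s \<le> t" "t < T" and x: "x \<in> U"
  shows "(I1 s t has_real_derivative I2 s t x) (at x within U)"
proof -
  have "((\<lambda>x. integral (cbox s t) (w1 x)) has_real_derivative integral (cbox s t) (w2 x)) (at x within U)"
  proof (rule leibniz_rule_field_derivative)
    show "continuous_on (U \<times> cbox s t) (\<lambda>(x, r). w2 x r)"
      using st by (intro continuous_on_subset[OF w2_cont]) auto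
    show "w1 y integrable_on cbox s t" if "y \<in> U" for y
      using st that R(1) unfolding interval_cbox[symmetric]
      by (intro integrable_continuous_interval continuous_on_compose_pair[OF w1_cont] continuous_intros) auto
    show "((\<lambda>x. w1 x r) has_real_derivative w2 y r) (at y within U)" if "y \<in> U" "r \<in> cbox s t" for y r
      using that st by (intro DERIV_subset[OF w1_dx U_subset]) auto
  qed (use x U_convex in auto)
  then show ?thesis
    by simp
qed

lemma I0_deriv:
  assumes st: "0 < s" "s \<le> t" "t < T" and x: "x \<in> U"
  shows "(I0 s t has_real_derivative I1 s t x) (at x within U)"
proof -
  have "((\<lambda>x. integral (cbox s t) (g x)) has_real_derivative integral (cbox s t) (w1 x)) (at x within U)"
  proof (rule leibniz_rule_field_derivative)
    show "continuous_on (U \<times> cbox s t) (\<lambda>(x, r). w1 x r)"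
      using st R(1) by (intro continuous_on_subset[OF w1_cont] Sigma_mono) auto
    show "g y integrable_on cbox s t" if "y \<in> U" for y
      using that U_subset unfolding interval_cbox[symmetric]
      by (intro integrable_continuous_interval continuous_intros) auto
    show "((\<lambda>x. g x r) has_real_derivative w1 y r) (at y within U)" if "y \<in> U" "r \<in> cbox s t" for y r
      using that st by (intro DERIV_subset[OF g_dx U_subset]) auto
  qed (use x U_convex in auto)
  then show ?thesis
    by simp
qed

lemma antideriv_deriv_U:
  "continuous_on {l..h} f \<Longrightarrow> x \<in> U \<Longrightarrow> (antideriv l f has_real_derivative f x) (at x within U)"
  using U_subset by (intro DERIV_subset[OF antideriv_deriv U_subset]) auto

text \<open>\<open>I2_eq\<close> integrated once from the vertex: both sides have the same
  derivative on \<open>U\<close> and the same value at 0.\<close>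

lemma I1_eq_U:
  assumes st: "0 < s" "s \<le> t" "t < T" and x: "x \<in> U"
  shows "I1 s t x = I1 s t 0 + I2 s t 0 * x + antideriv l (antideriv l (k s t)) x"
proof (rule same_derivative_imp_eq[OF U_convex, of 0 "I1 s t"
      "\<lambda>x. I1 s t 0 + I2 s t 0 * x + antideriv l (antideriv l (k s t)) x"
      "\<lambda>y. I2 s t 0 + antideriv l (k s t) y"])
  have ck: "continuous_on {l..h} (k s t)"
    using st by (intro k_continuous) auto
  fix y assume y: "y \<in> U"
  show "(I1 s t has_real_derivative I2 s t 0 + antideriv l (k s t) y) (at y within U)"
    using I1_deriv[OF st y] I2_eq[OF st y] by simp
  show "((\<lambda>x. I1 s t 0 + I2 s t 0 * x + antideriv l (antideriv l (k s t)) x) has_real_derivative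
      I2 s t 0 + antideriv l (k s t) y) (at y within U)"
    by (rule derivative_eq_intros antideriv_deriv_U[OF antideriv_continuous[OF ck] y] refl)+ simp
qed (use x in auto)

text \<open>Continuity of \<open>w1\<close> on \<open>R\<close> extends the formula to the far end
  when \<open>R\<close> contains it.\<close>

lemma I1_eq:
  assumes st: "0 < s" "s \<le> t" "t < T" and x: "x \<in> R"
  shows "I1 s t x = I1 s t 0 + I2 s t 0 * x + antideriv l (antideriv l (k s t)) x"
proof (rule continuous_on_eq_on_dense[OF _ _ _ R_closure _ x])
  have ck: "continuous_on {l..h} (k s t)"
    using st by (intro k_continuous) auto
  have "continuous_on (R \<times> {s..t}) (\<lambda>(x, r). w1 x r)"
    using st by (intro continuous_on_subset[OF w1_cont]) auto
  then show "continuous_on R (I1 s t)"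
    by (rule continuous_on_integral_param)
  show "continuous_on R (\<lambda>x. I1 s t 0 + I2 s t 0 * x + antideriv l (antideriv l (k s t)) x)"
    by (intro continuous_intros continuous_on_subset[OF antideriv_continuous[OF antideriv_continuous[OF ck]] R(2)])
qed (use R(1) in \<open>auto intro!: I1_eq_U[OF st]\<close>)

text \<open>Second integration: the Taylor polynomial of degree 2 at the vertex, with a triple
  antiderivative of \<open>k s t\<close> as remainder.\<close>

lemma I0_eq:
  assumes st: "0 < s" "s \<le> t" "t < T" and x: "x \<in> U"
  shows "I0 s t x = I0 s t 0 + I1 s t 0 * x + I2 s t 0 * (x\<^sup>2 / 2)
    + antideriv l (antideriv l (antideriv l (k s t))) x"
proof (rule same_derivative_imp_eq[OF U_convex, of 0 "I0 s t"
      "\<lambda>x. I0 s t 0 + I1 s t 0 * x + I2 s t 0 * (x\<^sup>2 / 2)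
        + antideriv l (antideriv l (antideriv l (k s t))) x"
      "\<lambda>y. I1 s t 0 + I2 s t 0 * y + antideriv l (antideriv l (k s t)) y"])
  have ck: "continuous_on {l..h} (k s t)"
    using st by (intro k_continuous) auto
  fix y assume y: "y \<in> U"
  show "(I0 s t has_real_derivative I1 s t 0 + I2 s t 0 * y + antideriv l (antideriv l (k s t)) y) (at y within U)"
    using I0_deriv[OF st y] I1_eq_U[OF st y] by simp
  show "((\<lambda>x. I0 s t 0 + I1 s t 0 * x + I2 s t 0 * (x\<^sup>2 / 2) + antideriv l (antideriv l (antideriv l (k s t))) x)
      has_real_derivative I1 s t 0 + I2 s t 0 * y + antideriv l (antideriv l (k s t)) y) (at y within U)"
    by (auto intro!: derivative_eq_intros antideriv_deriv_U[OF antideriv_continuous[OF antideriv_continuous[OF ck]] y])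
qed (use x in auto)

section \<open>Passage to the limit s \<rightarrow> 0\<close>

lemma tendsto_I0:
  assumes t: "t \<in> {0<..<T}" and x: "x \<in> {l..h}"
  shows "((\<lambda>s. I0 s t x) \<longlongrightarrow> prim x t) (at_right 0)"
proof -
  have "isCont (prim x) 0"
    using prim_deriv[OF x] by (rule DERIV_isCont)
  then have "(prim x \<longlongrightarrow> prim x 0) (at_right 0)"
    by (simp add: isCont_def filterlim_at_split)
  then have lim: "((\<lambda>s. prim x t - prim x s) \<longlongrightarrow> prim x t - 0) (at_right 0)"
    using prim_nonpos[OF x, of 0] by (intro tendsto_diff tendsto_const) simp
  have "\<forall>\<^sub>F s in at_right 0. prim x t - prim x s = I0 s t x"
  proof (rule eventually_at_rightI[of 0 t])
    fix s assume s: "s \<in> {0<..<t}"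
    have "integral {0..s} (g x) + integral {s..t} (g x) = integral {0..t} (g x)"
      using s x by (intro Henstock_Kurzweil_Integration.integral_combine integrable_continuous_interval continuous_intros) auto
    then show "prim x t - prim x s = I0 s t x"
      by (simp add: prim_def)
  qed (use t in auto)
  then show ?thesis
    using lim by (simp add: tendsto_cong)
qed

text \<open>On a bounded interval the antiderivative is linear and bounded in the supremum norm,
  hence preserves uniform limits.\<close>

lemma tendsto_antideriv:
  fixes f :: "real \<Rightarrow> real \<Rightarrow> real"
  assumes cont: "\<forall>\<^sub>F s in at_right 0. continuous_on {l..h} (f s)" "continuous_on {l..h} F"
    and lim: "uniform_limit {l..h} f F (at_right 0)"
  shows "uniform_limit {l..h} (\<lambda>s. antideriv l (f s)) (antideriv l F) (at_right 0)"
proof (rule uniform_limitI)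
  fix e :: real assume "0 < e"
  \<comment> \<open>Chosen so that the bound of \<open>antideriv_bound\<close> becomes e /
    2.\<close>
  define e' where "e' = e / 4 / (h - l)"
  have "(h - l) * e' = e / 4"
    using nonzero_mult_div_cancel_left[of "h - l" "e / 4"] l_less_h
    unfolding e'_def times_divide_eq_right by simp
  with \<open>0 < e\<close> have e'_less: "2 * ((h - l) * e') < e"
    by linarith
  have e'_pos: "0 < e'"
    using \<open>0 < e\<close> l_less_h by (simp add: e'_def)
  show "\<forall>\<^sub>F s in at_right 0. \<forall>x\<in>{l..h}. dist (antideriv l (f s) x) (antideriv l F x) < e"
    using uniform_limitD[OF lim e'_pos] cont(1)
  proof eventually_elim
    case (elim s)
    have bd: "\<bar>f s y - F y\<bar> \<le> e'" if "y \<in> {l..h}" for y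
      using bspec[OF elim(1) that] by (simp add: dist_real_def)
    have "\<bar>antideriv l (f s) x - antideriv l F x\<bar> \<le> 2 * ((h - l) * e')" if x: "x \<in> {l..h}" for x
      using antideriv_bound[OF continuous_on_diff[OF elim(2) cont(2)] bd x zero_in]
      by (simp only: antideriv_diff[OF elim(2) cont(2) x zero_in])
    then show ?case
      using e'_less by (force simp: dist_real_def)
  qed
qed

text \<open>The deviation is \<open>c * conv 0 x s\<close>, which \<open>conv_small\<close> makes
  uniformly small.\<close>

lemma uniform_limit_k:
  assumes t: "t \<in> {0<..<T}"
  shows "uniform_limit {l..h} (\<lambda>s. k s t) (\<lambda>x. c * conv 0 x t) (at_right 0)"
proof (rule uniform_limitI)
  obtain N where N: "0 \<le> N" "\<And>x t. x \<in> {l..h} \<Longrightarrow> t \<le> T \<Longrightarrow> \<bar>g x t\<bar> \<le> N"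
    using g_bounded by blast
  fix e :: real assume "0 < e"
  then have 1: "\<forall>\<^sub>F s in at_right 0. (\<bar>c\<bar> * N) * (s powr (1 - \<alpha>) / (1 - \<alpha>)) < e"
    using tendsto_kernel_error[OF \<alpha>_less_1] by (intro order_tendstoD)
  have 2: "\<forall>\<^sub>F s in at_right 0. s \<in> {0<..<T}"
    using T_pos by (intro eventually_at_rightI[of 0 T]) auto
  from 1 2 show "\<forall>\<^sub>F s in at_right 0. \<forall>x\<in>{l..h}. dist (k s t x) (c * conv 0 x t) < e"
  proof eventually_elim
    case (elim s)
    show ?case
    proof
      fix x assume x: "x \<in> {l..h}"
      have "\<bar>conv 0 x s\<bar> \<le> N * (s powr (1 - \<alpha>) / (1 - \<alpha>))"
        using elim x by (intro conv_small N) auto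
      from mult_left_mono[OF this abs_ge_zero[of c]]
      show "dist (k s t x) (c * conv 0 x t) < e"
        using elim by (simp add: dist_real_def abs_mult mult.assoc)
    qed
  qed
qed

text \<open>
  In the Taylor expansion \<open>I0_eq\<close> at the vertex, everything but the two Taylor coefficients is known
  to converge as \<open>s \<rightarrow> 0\<close>. Evaluation at two points of the bond shows that the coefficients converge too.
\<close>

lemma regularity:
  assumes t: "t \<in> {0<..<T}"
  shows "\<exists>W1 W2.
    (\<forall>x\<in>{l..h}. ((\<lambda>x. prim x t) has_real_derivative W1 x) (at x within {l..h})) \<and>
    (\<forall>x\<in>{l..h}. (W1 has_real_derivative W2 x) (at x within {l..h})) \<and>
    (\<forall>x\<in>{l..h}. (W2 has_real_derivative c * conv 0 x t) (at x within {l..h})) \<and>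
    (\<forall>x\<in>R. ((\<lambda>s. integral {s..t} (w1 x)) \<longlongrightarrow> W1 x) (at_right 0)) \<and>
    ((\<lambda>s. integral {s..t} (w2 0)) \<longlongrightarrow> W2 0) (at_right 0)"
proof -
  let ?K = "\<lambda>x. c * conv 0 x t"
  let ?A1 = "antideriv l" and ?A2 = "\<lambda>f. antideriv l (antideriv l f)"
    and ?A3 = "\<lambda>f. antideriv l (antideriv l (antideriv l f))"
  have cK: "continuous_on {l..h} ?K"
    using t by (intro conv_x_continuous) auto
  note cK1 = antideriv_continuous[OF cK]
  note cK2 = antideriv_continuous[OF cK1]
  have ev: "\<forall>\<^sub>F s in at_right 0. 0 < s \<and> s \<le> t"
    using t by (intro eventually_at_rightI[of 0 t]) auto
  have tT: "t < T"
    using t by simp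
  have ck: "\<forall>\<^sub>F s in at_right 0. continuous_on {l..h} (k s t)"
    using ev by eventually_elim (use t in \<open>auto intro!: k_continuous\<close>)
  have ck1: "\<forall>\<^sub>F s in at_right 0. continuous_on {l..h} (?A1 (k s t))"
    using ck by eventually_elim (rule antideriv_continuous)
  have ck2: "\<forall>\<^sub>F s in at_right 0. continuous_on {l..h} (?A2 (k s t))"
    using ck1 by eventually_elim (rule antideriv_continuous)
  note l1 = tendsto_antideriv[OF ck cK uniform_limit_k[OF t]]
  note l2 = tendsto_antideriv[OF ck1 cK1 l1]
  note l3 = tendsto_antideriv[OF ck2 cK2 l2]
  \<comment> \<open>The part of the Taylor formula carried by the two unknown coefficients; its
    limit is known at every point of the bond.\<close>
  define D where "D x s = I0 s t x - I0 s t 0 - ?A3 (k s t) x" for x s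
  have D: "(D x \<longlongrightarrow> prim x t - prim 0 t - ?A3 ?K x) (at_right 0)" if "x \<in> {l..h}" for x
    unfolding D_def using that zero_in
    by (intro tendsto_diff tendsto_I0[OF t] tendsto_uniform_limitI[OF l3]) auto
  have D_eq: "\<forall>\<^sub>F s in at_right 0. D x s = I1 s t 0 * x + I2 s t 0 * (x\<^sup>2 / 2)" if "x \<in> U" for x
    using ev by eventually_elim (use I0_eq[OF _ _ tT that] in \<open>auto simp: D_def\<close>)
  \<comment> \<open>One of l and h is 0, so \<open>2 * a\<close> is the midpoint of the bond and
    \<open>a\<close> lies halfway between it and the vertex.\<close>
  define a where "a = (l + h) / 4"
  have a: "a \<noteq> 0" "a \<in> {l<..<h}" "2 * a \<in> {l<..<h}"
    using l_less_h vertex by (auto simp: a_def field_simps)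
  have aU: "a \<in> U" "2 * a \<in> U"
    using a by auto
  \<comment> \<open>\<beta> and \<gamma> solve the two linear equations for the coefficients given
    by D at \<open>a\<close> and \<open>2 * a\<close>: \<open>4 * D a - D (2 * a)\<close> eliminates
    \<open>I2\<close>, and \<open>D (2 * a) - 2 * D a\<close> eliminates \<open>I1\<close>.\<close>
  define \<beta> where "\<beta> = (4 * (prim a t - prim 0 t - ?A3 ?K a) - (prim (2 * a) t - prim 0 t - ?A3 ?K (2 * a))) / (2 * a)"
  define \<gamma> where "\<gamma> = ((prim (2 * a) t - prim 0 t - ?A3 ?K (2 * a)) - 2 * (prim a t - prim 0 t - ?A3 ?K a)) / a\<^sup>2"
  have "((\<lambda>s. (4 * D a s - D (2 * a) s) / (2 * a)) \<longlongrightarrow> \<beta>) (at_right 0)"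
    unfolding \<beta>_def using a by (intro tendsto_intros D) auto
  moreover have "\<forall>\<^sub>F s in at_right 0. (4 * D a s - D (2 * a) s) / (2 * a) = I1 s t 0"
    using D_eq[OF aU(1)] D_eq[OF aU(2)]
    by eventually_elim (use a(1) in \<open>simp add: field_simps power2_eq_square\<close>)
  ultimately have \<beta>: "((\<lambda>s. I1 s t 0) \<longlongrightarrow> \<beta>) (at_right 0)"
    by (simp add: tendsto_cong)
  have "((\<lambda>s. (D (2 * a) s - 2 * D a s) / a\<^sup>2) \<longlongrightarrow> \<gamma>) (at_right 0)"
    unfolding \<gamma>_def using a by (intro tendsto_intros D) auto
  moreover have "\<forall>\<^sub>F s in at_right 0. (D (2 * a) s - 2 * D a s) / a\<^sup>2 = I2 s t 0"
    using D_eq[OF aU(1)] D_eq[OF aU(2)]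
    by eventually_elim (use a(1) in \<open>simp add: field_simps power2_eq_square\<close>)
  ultimately have \<gamma>: "((\<lambda>s. I2 s t 0) \<longlongrightarrow> \<gamma>) (at_right 0)"
    by (simp add: tendsto_cong)
  have prim_U: "prim x t = prim 0 t + \<beta> * x + \<gamma> * (x\<^sup>2 / 2) + ?A3 ?K x" if x: "x \<in> U" for x
  proof -
    have "(D x \<longlongrightarrow> \<beta> * x + \<gamma> * (x\<^sup>2 / 2)) (at_right 0)"
      using D_eq[OF x] by (subst tendsto_cong) (auto intro!: tendsto_intros \<beta> \<gamma>)
    from tendsto_unique[OF _ this D] show ?thesis
      using x U_subset by auto
  qed
  \<comment> \<open>Continuity of \<open>prim\<close> extends the limiting Taylor formula to the far
    end. Its right side is three times differentiable there, which is how \<open>prim\<close> gains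
    derivatives at that end.\<close>
  have prim_eq: "prim x t = prim 0 t + \<beta> * x + \<gamma> * (x\<^sup>2 / 2) + ?A3 ?K x" if x: "x \<in> {l..h}" for x
  proof (rule continuous_on_eq_on_dense[of "{l..h}" "\<lambda>x. prim x t"
        "\<lambda>x. prim 0 t + \<beta> * x + \<gamma> * (x\<^sup>2 / 2) + ?A3 ?K x" "{l<..<h}"])
    show "continuous_on {l..h} (\<lambda>x. prim x t)"
      using t by (intro continuous_intros) auto
    show "continuous_on {l..h} (\<lambda>x. prim 0 t + \<beta> * x + \<gamma> * (x\<^sup>2 / 2) + ?A3 ?K x)"
      by (intro continuous_intros antideriv_continuous[OF cK2]) auto
    show "prim y t = prim 0 t + \<beta> * y + \<gamma> * (y\<^sup>2 / 2) + ?A3 ?K y" if "y \<in> {l<..<h}" for y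
      using that by (intro prim_U) simp
  qed (use x l_less_h in \<open>auto simp: closure_greaterThanLessThan\<close>)
  show ?thesis
  \<comment> \<open>The witnesses are the first two x-derivatives of the limiting Taylor
    formula.\<close>
  proof (rule exI[of _ "\<lambda>x. \<beta> + \<gamma> * x + ?A2 ?K x"], rule exI[of _ "\<lambda>x. \<gamma> + ?A1 ?K x"], intro conjI ballI)
    fix x assume x: "x \<in> {l..h}"
    have "((\<lambda>x. prim 0 t + \<beta> * x + \<gamma> * (x\<^sup>2 / 2) + ?A3 ?K x) has_real_derivative
        \<beta> + \<gamma> * x + ?A2 ?K x) (at x within {l..h})"
      by (auto intro!: derivative_eq_intros antideriv_deriv[OF cK2 x])
    then show "((\<lambda>x. prim x t) has_real_derivative \<beta> + \<gamma> * x + ?A2 ?K x) (at x within {l..h})"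
    proof (rule has_field_derivative_transform_within[where d = 1])
      show "prim 0 t + \<beta> * y + \<gamma> * (y\<^sup>2 / 2) + ?A3 ?K y = prim y t" if "y \<in> {l..h}" for y
        using that by (rule prim_eq[symmetric])
    qed (use x in auto)
    show "((\<lambda>x. \<beta> + \<gamma> * x + ?A2 ?K x) has_real_derivative \<gamma> + ?A1 ?K x) (at x within {l..h})"
      by (rule derivative_eq_intros antideriv_deriv[OF cK1 x] refl)+ simp
    show "((\<lambda>x. \<gamma> + ?A1 ?K x) has_real_derivative c * conv 0 x t) (at x within {l..h})"
      by (rule derivative_eq_intros antideriv_deriv[OF cK x] refl)+ simp
  next
    fix x assume x: "x \<in> R"
    have "((\<lambda>s. I1 s t 0 + I2 s t 0 * x + ?A2 (k s t) x) \<longlongrightarrow> \<beta> + \<gamma> * x + ?A2 ?K x) (at_right 0)"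
      using x R(2) by (intro tendsto_intros \<beta> \<gamma> tendsto_uniform_limitI[OF l2]) auto
    moreover have "\<forall>\<^sub>F s in at_right 0. I1 s t 0 + I2 s t 0 * x + ?A2 (k s t) x = I1 s t x"
      using ev by eventually_elim (use I1_eq[OF _ _ tT x] in auto)
    ultimately show "((\<lambda>s. I1 s t x) \<longlongrightarrow> \<beta> + \<gamma> * x + ?A2 ?K x) (at_right 0)"
      by (simp add: tendsto_cong)
  qed (use \<gamma> in simp)
qed

end

subsection \<open>The energy argument\<close>

text \<open>In the derivative of \<open>W0 * W2 - W1\<^sup>2 / 2\<close> the terms
  \<open>W1 * W2\<close> cancel and \<open>W0 * W3\<close> remains.\<close>

lemma integral_by_energy:
  fixes W0 W1 W2 W3 :: "real \<Rightarrow> real"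
  assumes "l \<le> h"
    and "\<And>x. x \<in> {l..h} \<Longrightarrow> (W0 has_real_derivative W1 x) (at x within {l..h})"
    and "\<And>x. x \<in> {l..h} \<Longrightarrow> (W1 has_real_derivative W2 x) (at x within {l..h})"
    and "\<And>x. x \<in> {l..h} \<Longrightarrow> (W2 has_real_derivative W3 x) (at x within {l..h})"
  shows "integral {l..h} (\<lambda>x. W0 x * W3 x)
    = (W0 h * W2 h - (W1 h)\<^sup>2 / 2) - (W0 l * W2 l - (W1 l)\<^sup>2 / 2)"
proof (rule integral_unique, rule fundamental_theorem_of_calculus[where f = "\<lambda>x. W0 x * W2 x - (W1 x)\<^sup>2 / 2"])
  fix x assume x: "x \<in> {l..h}"
  have "((\<lambda>x. W0 x * W2 x - (W1 x)\<^sup>2 / 2) has_real_derivative W0 x * W3 x) (at x within {l..h})"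
    by (auto intro!: derivative_eq_intros assms(2-4)[OF x])
  then show "((\<lambda>x. W0 x * W2 x - (W1 x)\<^sup>2 / 2) has_vector_derivative W0 x * W3 x) (at x within {l..h})"
    by (simp add: has_real_derivative_iff_has_vector_derivative)
qed fact

text \<open>The maximum argument for a finite family of bonds, with the boundary analysis condensed
  into the sign condition \<open>dissip\<close>. That condition concerns times before T, and so does
  the conclusion.\<close>

lemma energy_uniqueness:
  fixes g :: "'j \<Rightarrow> real \<Rightarrow> real \<Rightarrow> real"
  assumes J: "finite J" and T: "0 < T" and \<alpha>: "0 < \<alpha>" "\<alpha> < 1"
    and causal: "\<And>j. j \<in> J \<Longrightarrow> causal \<alpha> T (l j) (h j) (g j)"
    and dissip: "\<And>t. t \<in> {0<..<T} \<Longrightarrow>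
      (\<Sum>j\<in>J. integral {l j..h j} (\<lambda>x. causal.prim (g j) x t * causal.conv \<alpha> T (g j) 0 x t)) \<le> 0"
    and j: "j \<in> J" and x: "x \<in> {l j..h j}" and t: "t \<in> {0..<T}"
  shows "g j x t = 0"
proof -
  define P where "P j = causal.prim (g j)" for j
  define K where "K j = causal.conv \<alpha> T (g j) 0" for j
  define E where "E s = (\<Sum>j\<in>J. integral {l j..h j} (\<lambda>x. (P j x s)\<^sup>2))" for s
  note P_nonpos = causal.prim_nonpos[OF causal, folded P_def]
    and P_deriv = causal.prim_deriv[OF causal, folded P_def]
    and P_cont = causal.continuous_on_prim[OF causal, folded P_def]
  have Px_cont: "continuous_on {l j..h j} (\<lambda>x. P j x s)" if "j \<in> J" "s \<le> T" for j s
    using that by (intro P_cont continuous_intros) auto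
  \<comment> \<open>A square that is not integrable has integral 0 by convention, so the inequality
    holds for all sets and times.\<close>
  have sq_nonneg: "0 \<le> integral S (\<lambda>x. (P j x s)\<^sup>2)" for S j s
    by (cases "(\<lambda>x. (P j x s)\<^sup>2) integrable_on S")
      (auto intro: integral_nonneg simp: not_integrable_integral)
  have E_nonneg: "0 \<le> E s" for s
    unfolding E_def by (intro sum_nonneg sq_nonneg)
  \<comment> \<open>\<open>T' < T\<close> ensures that a positive maximiser of E lies in the open
    interval where \<open>dissip\<close> is available.\<close>
  have P_zero: "P j x s = 0" if T': "0 < T'" "T' < T" and j: "j \<in> J" and x: "x \<in> {l j..h j}" and s: "s \<in> {0..T'}" for T' j x s
  proof -
    have "continuous_on {0..T'} E"
      unfolding E_def
    proof (intro continuous_on_sum continuous_on_integral_param)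
      fix j assume "j \<in> J"
      then show "continuous_on ({0..T'} \<times> {l j..h j}) (\<lambda>(s, x). (P j x s)\<^sup>2)"
        unfolding case_prod_beta using T' by (intro continuous_on_power P_cont continuous_intros) auto
    qed
    then obtain t0 where t0: "t0 \<in> {0..T'}" and max: "\<And>s. s \<in> {0..T'} \<Longrightarrow> E s \<le> E t0"
      using continuous_attains_sup[of "{0..T'}" E] T' by auto
    have "E t0 \<le> 0"
    proof (cases "t0 = 0")
      case True
      have "integral {l j..h j} (\<lambda>x. (P j x t0)\<^sup>2) = 0" if "j \<in> J" for j
        using that True by (intro integral_unique has_integral_is_0) (auto simp: P_nonpos)
      then show ?thesis
        by (simp add: E_def)
    next
      case False
      then have t0T: "t0 \<in> {0<..<T}" "t0 \<le> T"
        using t0 T' by auto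
      define Q where "Q s = (\<Sum>j\<in>J. integral {l j..h j} (\<lambda>x. P j x t0 * P j x s))" for s
      define q where "q s = (\<Sum>j\<in>J. integral {l j..h j} (\<lambda>x. P j x t0 * g j x s))" for s
      have Q_deriv: "(Q has_real_derivative q s) (at s within {..T})" if "s \<le> T" for s
        unfolding Q_def q_def
        by (intro DERIV_sum causal.pairing_deriv[OF causal, folded P_def] Px_cont that t0T)
      have Q_at: "(Q has_real_derivative q s) (at s)" if "s < T" for s
      proof -
        have "(Q has_real_derivative q s) (at s within {..<T})"
          using that by (intro DERIV_subset[OF Q_deriv]) auto
        then show ?thesis
          using at_within_open[of s "{..<T}"] that by simp
      qed
      have Q_cont: "continuous_on {..T} Q"
        by (rule DERIV_continuous_on) (use Q_deriv in auto)
      have Q_t0: "Q t0 = E t0"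
        by (simp add: Q_def E_def power2_eq_square)
      have Q_nonpos: "Q s = 0" if "s \<le> 0" for s
        unfolding Q_def
      proof (intro sum.neutral ballI)
        fix j assume "j \<in> J"
        then show "integral {l j..h j} (\<lambda>x. P j x t0 * P j x s) = 0"
          using that by (intro integral_unique has_integral_is_0) (auto simp: P_nonpos)
      qed
      have Q_le: "Q s \<le> Q t0" if "s \<le> t0" for s
      proof (cases "s \<le> 0")
        case True
        then show ?thesis
          using Q_nonpos Q_t0 E_nonneg by simp
      next
        case False
        then have s: "s \<in> {0..T'}" "s \<le> T"
          using that t0 T' by auto
        have "Q s \<le> (\<Sum>j\<in>J. integral {l j..h j} (\<lambda>x. (P j x t0)\<^sup>2 / 2 + (P j x s)\<^sup>2 / 2))"
          unfolding Q_def
        proof (intro sum_mono integral_le integrable_continuous_interval)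
          fix j x assume "j \<in> J"
          show "P j x t0 * P j x s \<le> (P j x t0)\<^sup>2 / 2 + (P j x s)\<^sup>2 / 2"
            using sum_squares_bound[of "P j x t0" "P j x s"] by simp
        qed (use s t0T in \<open>auto intro!: continuous_intros Px_cont\<close>)
        also have "\<dots> = (\<Sum>j\<in>J. integral {l j..h j} (\<lambda>x. (P j x t0)\<^sup>2) / 2 + integral {l j..h j} (\<lambda>x. (P j x s)\<^sup>2) / 2)"
        proof (intro sum.cong refl)
          fix j assume "j \<in> J"
          then show "integral {l j..h j} (\<lambda>x. (P j x t0)\<^sup>2 / 2 + (P j x s)\<^sup>2 / 2)
              = integral {l j..h j} (\<lambda>x. (P j x t0)\<^sup>2) / 2 + integral {l j..h j} (\<lambda>x. (P j x s)\<^sup>2) / 2"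
            using s t0T by (subst integral_add) (auto intro!: integrable_continuous_interval continuous_intros Px_cont)
        qed
        also have "\<dots> = E t0 / 2 + E s / 2"
          by (simp add: E_def sum.distrib sum_divide_distrib)
        finally show ?thesis
          using max[OF s(1)] Q_t0 by simp
      qed
      let ?N = "\<lambda>j d. integral {d..T} (\<lambda>s. integral {l j..h j} (\<lambda>x. P j x t0 * g j x (t0 - s)) * s powr -\<alpha>)"
      have "\<forall>j\<in>J. \<exists>C. \<forall>d\<in>{0<..T}. ?N j d
          \<le> integral {l j..h j} (\<lambda>x. P j x t0 * K j x t0) + C * (d powr (1 - \<alpha>) / (1 - \<alpha>))"
        using causal.pairing_conv[OF causal Px_cont t0T(2), folded K_def] t0T(2) by blast
      from bchoice[OF this] obtain C where C: "\<forall>j\<in>J. \<forall>d\<in>{0<..T}. ?N j d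
          \<le> integral {l j..h j} (\<lambda>x. P j x t0 * K j x t0) + C j * (d powr (1 - \<alpha>) / (1 - \<alpha>))" ..
      let ?D = "\<lambda>d. (\<Sum>j\<in>J. C j) * (d powr (1 - \<alpha>) / (1 - \<alpha>))"
      have bound: "Q t0 * T powr -\<alpha> \<le> ?D d - (Q (t0 - d) - Q t0) / d * d powr (1 - \<alpha>)"
        if d: "d \<in> {0<..<T}" for d
      proof -
        have qc: "continuous_on {d..T} (\<lambda>s. integral {l j..h j} (\<lambda>x. P j x t0 * g j x (t0 - s)))" if "j \<in> J" for j
          by (rule continuous_on_compose2[OF causal.pairing_continuous[OF causal[OF that] Px_cont[OF that t0T(2)]]])
            (auto intro!: continuous_intros)
        have "((\<lambda>s. q (t0 - s) * s powr -\<alpha>) has_integral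
            (Q (t0 - d) - Q t0) * d powr -\<alpha> - (Q (t0 - T) - Q t0) * T powr -\<alpha>
              - \<alpha> * integral {d..T} (\<lambda>s. (Q (t0 - s) - Q t0) * s powr (-\<alpha> - 1))) {d..T}"
        \<comment> \<open>Subtracting \<open>Q t0\<close> makes the function nonpositive up to
          \<open>t0\<close>, so the remaining singular integral has a favourable sign. As
          \<open>Q (t0 - T) = 0\<close>, the boundary term at s = T is the wanted
          \<open>Q t0 * T powr -\<alpha>\<close>.\<close>
        proof (rule kernel_by_parts[where F = "\<lambda>s. Q s - Q t0"])
          show "continuous_on {t0 - T..t0 - d} (\<lambda>s. Q s - Q t0)"
            using t0T d by (intro continuous_intros continuous_on_subset[OF Q_cont]) auto
          show "((\<lambda>s. Q s - Q t0) has_real_derivative q r) (at r)" if "r \<in> {t0 - T<..<t0 - d}" for r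
            using that d t0T DERIV_diff[OF Q_at DERIV_const, of r] by auto
        qed (use d in auto)
        moreover have "integral {d..T} (\<lambda>s. (Q (t0 - s) - Q t0) * s powr (-\<alpha> - 1)) \<le> 0"
        proof -
          have "(\<lambda>s. (Q (t0 - s) - Q t0) * s powr (-\<alpha> - 1)) integrable_on {d..T}"
            using d t0T by (intro integrable_continuous_interval continuous_intros
                continuous_on_compose2[OF Q_cont]) auto
          then have "integral {d..T} (\<lambda>s. (Q (t0 - s) - Q t0) * s powr (-\<alpha> - 1)) \<le> integral {d..T} (\<lambda>_. 0)"
            using Q_le d by (intro integral_le) (auto intro!: mult_nonpos_nonneg)
          then show ?thesis
            by simp
        qed
        then have "\<alpha> * integral {d..T} (\<lambda>s. (Q (t0 - s) - Q t0) * s powr (-\<alpha> - 1)) \<le> 0"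
          using \<alpha> by (simp add: mult_nonneg_nonpos)
        moreover have "Q (t0 - T) = 0"
          using t0T by (intro Q_nonpos) auto
        ultimately have "(Q (t0 - d) - Q t0) * d powr -\<alpha> + Q t0 * T powr -\<alpha>
            \<le> integral {d..T} (\<lambda>s. q (t0 - s) * s powr -\<alpha>)"
          by (simp add: integral_unique)
        also have "integral {d..T} (\<lambda>s. q (t0 - s) * s powr -\<alpha>)
            = (\<Sum>j\<in>J. integral {d..T} (\<lambda>s. integral {l j..h j} (\<lambda>x. P j x t0 * g j x (t0 - s)) * s powr -\<alpha>))"
          unfolding q_def sum_distrib_right using J d
          by (intro integral_sum integrable_continuous_interval) (auto intro!: continuous_intros qc)
        also have "\<dots> \<le> (\<Sum>j\<in>J. integral {l j..h j} (\<lambda>x. P j x t0 * K j x t0) + C j * (d powr (1 - \<alpha>) / (1 - \<alpha>)))"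
          using d by (intro sum_mono C[rule_format]) auto
        also have "\<dots> \<le> ?D d"
          using dissip[OF t0T(1), folded P_def K_def] by (simp add: sum.distrib sum_distrib_right sum_divide_distrib)
        finally have "(Q (t0 - d) - Q t0) * d powr -\<alpha> + Q t0 * T powr -\<alpha> \<le> ?D d" .
        moreover have "d powr -\<alpha> = d powr (1 - \<alpha>) / d"
          using d by (simp add: powr_diff powr_minus_divide)
        ultimately show ?thesis
          by simp
      qed
      \<comment> \<open>The boundary term at s = d is a difference quotient of Q times
        \<open>d powr (1 - \<alpha>)\<close>. Q is differentiable at \<open>t0\<close>, so the
        quotient converges and the term vanishes as d \<rightarrow> 0.\<close>
      have "((\<lambda>s. Q (t0 - s)) has_real_derivative q t0 * - 1) (at 0)"
        using t0T by (intro DERIV_chain2[of Q]) (auto intro!: derivative_eq_intros Q_at)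
      then have "((\<lambda>d. (Q (t0 - d) - Q t0) / d) \<longlongrightarrow> - q t0) (at_right 0)"
        by (simp add: DERIV_def filterlim_at_split)
      moreover have "((\<lambda>d. d powr (1 - \<alpha>)) \<longlongrightarrow> 0) (at_right 0)"
        using tendsto_kernel_error[OF \<alpha>(2), of "1 - \<alpha>"] \<alpha> by simp
      ultimately have "((\<lambda>d. ?D d - (Q (t0 - d) - Q t0) / d * d powr (1 - \<alpha>)) \<longlongrightarrow> 0 - - q t0 * 0) (at_right 0)"
        by (intro tendsto_diff tendsto_kernel_error tendsto_mult \<alpha>)
      moreover have "\<forall>\<^sub>F d in at_right 0. Q t0 * T powr -\<alpha> \<le> ?D d - (Q (t0 - d) - Q t0) / d * d powr (1 - \<alpha>)"
        using bound T by (intro eventually_at_rightI[of 0 T]) auto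
      ultimately have "Q t0 * T powr -\<alpha> \<le> 0 - - q t0 * 0"
        by (rule tendsto_lowerbound) simp
      moreover have "0 < T powr -\<alpha>"
        using T by simp
      ultimately show ?thesis
        unfolding Q_t0 by (simp add: mult_le_0_iff)
    qed
    then have "E s = 0"
      using max[OF s] E_nonneg[of s] by simp
    then have "integral {l j..h j} (\<lambda>x. (P j x s)\<^sup>2) = 0"
      unfolding E_def using J j by (subst (asm) sum_nonneg_eq_0_iff) (auto intro: sq_nonneg)
    moreover have "continuous_on {l j..h j} (\<lambda>x. (P j x s)\<^sup>2)"
      using s T' by (intro continuous_intros Px_cont j) auto
    ultimately show ?thesis
      using x causal.l_less_h[OF causal[OF j]] by (subst (asm) integral_eq_0_iff) auto
  qed
  show ?thesis
  proof (cases "t = 0")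
    case True
    then show ?thesis
      using causal.g_causal[OF causal[OF j] x] by simp
  next
    case False
    then have tT: "t \<in> {0<..<T}"
      using t by auto
    \<comment> \<open>The primitive is 0 throughout the open time interval, so its derivative g is 0
      as well.\<close>
    have "(P j x has_real_derivative 0) (at t)"
    proof (rule has_field_derivative_transform_within_open[OF DERIV_const open_greaterThanLessThan tT])
      fix r assume "r \<in> {0<..<T}"
      then show "0 = P j x r"
        using P_zero[OF _ _ j x, of r r] by simp
    qed
    then show ?thesis
      using DERIV_unique P_deriv[OF j x] by blast
  qed
qed

text \<open>The quadratic form of \<open>transpose_mat B * B - 1\<^sub>m k\<close> at p is the
  squared length of Bp minus that of p. The zero vector, which definiteness excludes, is a separate
  case.\<close>

lemma contraction_of_neg_definite:
  assumes B: "B \<in> carrier_mat m k"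
    and nd: "neg_definite_mat k (transpose_mat B * B - 1\<^sub>m k)"
    and p: "p \<in> carrier_vec k"
  shows "(\<Sum>i<m. (vec_index (B *\<^sub>v p) i)\<^sup>2) \<le> (\<Sum>i<k. (vec_index p i)\<^sup>2)"
proof -
  have sq: "scalar_prod v v = (\<Sum>i<n. (vec_index v i)\<^sup>2)" if "v \<in> carrier_vec n" for v :: "real Matrix.vec" and n
    using that by (simp add: scalar_prod_def power2_eq_square atLeast0LessThan)
  have "scalar_prod p ((transpose_mat B * B - 1\<^sub>m k) *\<^sub>v p) \<le> 0"
    using nd p unfolding neg_definite_mat_def by (cases "p = 0\<^sub>v k") (auto simp: less_imp_le)
  moreover have "(transpose_mat B * B - 1\<^sub>m k) *\<^sub>v p = transpose_mat B *\<^sub>v (B *\<^sub>v p) - p"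
    using B p by (simp add: minus_mult_distrib_mat_vec[of _ k k])
  moreover have "scalar_prod p (transpose_mat B *\<^sub>v (B *\<^sub>v p) - p)
      = scalar_prod p (transpose_mat B *\<^sub>v (B *\<^sub>v p)) - scalar_prod p p"
    using B p by (intro scalar_prod_minus_distrib) auto
  moreover have "scalar_prod p (transpose_mat B *\<^sub>v (B *\<^sub>v p)) = scalar_prod (B *\<^sub>v p) (B *\<^sub>v p)"
  proof -
    have "scalar_prod p (transpose_mat B *\<^sub>v (B *\<^sub>v p)) = scalar_prod (transpose_mat B *\<^sub>v (B *\<^sub>v p)) p"
      using B p by (intro comm_scalar_prod[of _ k]) auto
    then show ?thesis
      using B p by (simp add: transpose_vec_mult_scalar[of B m k])
  qed
  ultimately show ?thesis
    unfolding sq[OF p, symmetric] sq[OF mult_mat_vec_carrier[OF B p], symmetric] by simp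
qed

subsection \<open>Uniqueness on the star graph\<close>

lemma dx_works:
  assumes "(\<lambda>y. w y t) differentiable (at x within S)"
  shows "((\<lambda>y. w y t) has_real_derivative dx S w x t) (at x within S)"
  using assms unfolding dx_def has_real_derivative_iff_has_vector_derivative vector_derivative_works .

lemma classical_onD:
  assumes "classical_on \<alpha> T b c r1 r2 w"
  shows "continuous_on (c \<times> {0..T}) (\<lambda>(x, t). w x t)"
    and "\<And>x t. x \<in> r1 \<Longrightarrow> t \<in> {0<..T} \<Longrightarrow> ((\<lambda>y. w y t) has_real_derivative dx c w x t) (at x within c)"
    and "continuous_on (r1 \<times> {0<..T}) (\<lambda>(x, t). dx c w x t)"
    and "\<And>x t. x \<in> r2 \<Longrightarrow> t \<in> {0<..T} \<Longrightarrow>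
      ((\<lambda>y. dx c w y t) has_real_derivative dx c (dx c w) x t) (at x within c)"
    and "continuous_on (r2 \<times> {0<..T}) (\<lambda>(x, t). dx c (dx c w) x t)"
    and "\<And>x t. x \<in> b \<Longrightarrow> t \<in> {0<..T} \<Longrightarrow>
      ((\<lambda>y. dx c (dx c w) y t) has_real_derivative dx c (dx c (dx c w)) x t) (at x within c)"
    and "\<And>x t. x \<in> b \<Longrightarrow> t \<in> {0<..<T} \<Longrightarrow> (w x has_real_derivative deriv (w x) t) (at t)"
    and "continuous_on (b \<times> {0<..<T}) (\<lambda>(x, t). deriv (w x) t)"
    and "\<And>x t. x \<in> b \<Longrightarrow> t \<in> {0<..T} \<Longrightarrow> caputo_integrand \<alpha> (w x) t integrable_on {0..t}"
proof -
  note c = assms[unfolded classical_on_def]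
  from c show "continuous_on (c \<times> {0..T}) (\<lambda>(x, t). w x t)"
    and "continuous_on (r1 \<times> {0<..T}) (\<lambda>(x, t). dx c w x t)"
    and "continuous_on (r2 \<times> {0<..T}) (\<lambda>(x, t). dx c (dx c w) x t)"
    and "continuous_on (b \<times> {0<..<T}) (\<lambda>(x, t). deriv (w x) t)"
    and "\<And>x t. x \<in> b \<Longrightarrow> t \<in> {0<..T} \<Longrightarrow> caputo_integrand \<alpha> (w x) t integrable_on {0..t}"
    by blast+
  fix x t
  show "((\<lambda>y. w y t) has_real_derivative dx c w x t) (at x within c)" if "x \<in> r1" "t \<in> {0<..T}"
    by (rule dx_works) (use c that in blast)
  show "((\<lambda>y. dx c w y t) has_real_derivative dx c (dx c w) x t) (at x within c)" if "x \<in> r2" "t \<in> {0<..T}"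
    by (rule dx_works) (use c that in blast)
  show "((\<lambda>y. dx c (dx c w) y t) has_real_derivative dx c (dx c (dx c w)) x t) (at x within c)"
    if "x \<in> b" "t \<in> {0<..T}"
    by (rule dx_works) (use c that in blast)
  show "(w x has_real_derivative deriv (w x) t) (at t)" if "x \<in> b" "t \<in> {0<..<T}"
  proof -
    have "w x differentiable (at t)"
      using c that by blast
    then show ?thesis
      by (simp add: DERIV_deriv_iff_real_differentiable)
  qed
qed

lemma continuous_on_diff_pair:
  fixes f g :: "'a::topological_space \<Rightarrow> 'b::topological_space \<Rightarrow> real"
  assumes "continuous_on S (\<lambda>(x, t). f x t)" "continuous_on S (\<lambda>(x, t). g x t)"
  shows "continuous_on S (\<lambda>(x, t). f x t - g x t)"
  using continuous_on_diff[OF assms] by (simp add: case_prod_beta)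

text \<open>Clamping time to [0, T] gives a continuous function on all times, zero up to time 0
  because the initial values agree. Inside (0, T) the clamp is the identity, so derivatives are
  unchanged, and the right-hand side f cancels.\<close>

lemma airy_bond_difference:
  fixes u v :: "real \<Rightarrow> real \<Rightarrow> real"
  assumes "0 < \<alpha>" "\<alpha> < 1" "0 < T" "l < h" "l = 0 \<or> h = 0"
    and R: "insert 0 {l<..<h} \<subseteq> R" "R \<subseteq> {l..h}"
    and u: "classical_on \<alpha> T {l<..<h} {l..h} R (insert 0 {l<..<h}) u"
    and v: "classical_on \<alpha> T {l<..<h} {l..h} R (insert 0 {l<..<h}) v"
    and init: "\<And>x. x \<in> {l..h} \<Longrightarrow> u x 0 = v x 0"
    and eq: "\<And>x t. x \<in> {l<..<h} \<Longrightarrow> t \<in> {0<..T} \<Longrightarrow>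
      caputo \<alpha> (u x) t - dx {l..h} (dx {l..h} (dx {l..h} u)) x t
      = caputo \<alpha> (v x) t - dx {l..h} (dx {l..h} (dx {l..h} v)) x t"
  shows "airy_bond \<alpha> T l h (\<lambda>x t. u x (max 0 (min T t)) - v x (max 0 (min T t))) (1 / Gamma (1 - \<alpha>))
    (\<lambda>x t. dx {l..h} u x t - dx {l..h} v x t)
    (\<lambda>x t. dx {l..h} (dx {l..h} u) x t - dx {l..h} (dx {l..h} v) x t)
    (\<lambda>x t. deriv (u x) t - deriv (v x) t) R"
proof
  let ?c = "{l..h}"
  note U = classical_onD[OF u] and V = classical_onD[OF v]
  have integrand: "caputo_integrand \<alpha> f t = (\<lambda>r. deriv f r * (t - r) powr -\<alpha>)" for f t
    by (simp add: caputo_integrand_def powr_minus divide_inverse)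
  have sub: "S \<times> {0<..<T} \<subseteq> S \<times> {0<..T}" for S :: "real set"
    by auto
  let ?cl = "\<lambda>t. max 0 (min T t)"
  have cl: "?cl t = t" if "t \<in> {0<..<T}" for t
    using that by simp
  show "continuous_on (?c \<times> UNIV) (\<lambda>(x, t). u x (?cl t) - v x (?cl t))"
    unfolding case_prod_beta using \<open>0 < T\<close>
    by (intro continuous_on_compose_pair[OF continuous_on_diff_pair[OF U(1) V(1)]] continuous_intros) auto
  show "u x (?cl t) - v x (?cl t) = 0" if "x \<in> ?c" "t \<le> 0" for x t
    using that init \<open>0 < T\<close> by (simp add: max_def min_def)
  show "continuous_on (R \<times> {0<..<T}) (\<lambda>(x, t). dx ?c u x t - dx ?c v x t)"
    by (rule continuous_on_subset[OF continuous_on_diff_pair[OF U(3) V(3)] sub])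
  show "continuous_on (insert 0 {l<..<h} \<times> {0<..<T}) (\<lambda>(x, t). dx ?c (dx ?c u) x t - dx ?c (dx ?c v) x t)"
    by (rule continuous_on_subset[OF continuous_on_diff_pair[OF U(5) V(5)] sub])
  show "continuous_on ({l<..<h} \<times> {0<..<T}) (\<lambda>(x, t). deriv (u x) t - deriv (v x) t)"
    by (rule continuous_on_diff_pair[OF U(8) V(8)])
  fix x t
  {
    assume x: "x \<in> insert 0 {l<..<h}" and "t \<in> {0<..<T}"
    then have xR: "x \<in> R" and t: "t \<in> {0<..T}"
      using R(1) by auto
    show "((\<lambda>y. u y (?cl t) - v y (?cl t)) has_real_derivative dx ?c u x t - dx ?c v x t) (at x within ?c)"
      using DERIV_diff[OF U(2)[OF xR t] V(2)[OF xR t]] cl[OF \<open>t \<in> {0<..<T}\<close>] by simp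
    show "((\<lambda>y. dx ?c u y t - dx ?c v y t) has_real_derivative
        dx ?c (dx ?c u) x t - dx ?c (dx ?c v) x t) (at x within ?c)"
      by (rule DERIV_diff[OF U(4)[OF x t] V(4)[OF x t]])
  next
    assume x: "x \<in> {l<..<h}" and t: "t \<in> {0<..<T}"
    then have t': "t \<in> {0<..T}"
      by auto
    show "((\<lambda>t. u x (?cl t) - v x (?cl t)) has_real_derivative deriv (u x) t - deriv (v x) t) (at t)"
      by (rule has_field_derivative_transform_within_open[OF DERIV_diff[OF U(7)[OF x t] V(7)[OF x t]]
            open_greaterThanLessThan t]) (simp only: cl)
    note int = U(9)[OF x t', unfolded integrand] V(9)[OF x t', unfolded integrand]
    from integrable_diff[OF int]
    show "(\<lambda>r. (deriv (u x) r - deriv (v x) r) * (t - r) powr -\<alpha>) integrable_on {0..t}"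
      by (simp add: left_diff_distrib)
    have "((\<lambda>y. dx ?c (dx ?c u) y t - dx ?c (dx ?c v) y t) has_real_derivative
        dx ?c (dx ?c (dx ?c u)) x t - dx ?c (dx ?c (dx ?c v)) x t) (at x within ?c)"
      by (rule DERIV_diff[OF U(6)[OF x t'] V(6)[OF x t']])
    moreover have "at x within ?c = at x"
      using x by (intro at_within_interior) auto
    moreover have "dx ?c (dx ?c (dx ?c u)) x t - dx ?c (dx ?c (dx ?c v)) x t
        = 1 / Gamma (1 - \<alpha>) * integral {0..t} (\<lambda>r. (deriv (u x) r - deriv (v x) r) * (t - r) powr -\<alpha>)"
      using eq[OF x t'] integral_diff[OF int]
      by (simp add: caputo_def integrand left_diff_distrib diff_divide_distrib)
    ultimately show "((\<lambda>y. dx ?c (dx ?c u) y t - dx ?c (dx ?c v) y t) has_real_derivative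
        1 / Gamma (1 - \<alpha>) * integral {0..t} (\<lambda>r. (deriv (u x) r - deriv (v x) r) * (t - r) powr -\<alpha>)) (at x)"
      by simp
  }
qed (use assms(1-5) R init in \<open>simp_all only: diff_self\<close>)

theorem theorem3:
  fixes \<alpha> T :: real and k m :: nat and a L :: "nat \<Rightarrow> real" and B :: "real mat"
    and f :: "nat \<Rightarrow> real \<Rightarrow> real \<Rightarrow> real" and u0 \<phi>0 \<phi>1 :: "nat \<Rightarrow> real \<Rightarrow> real"
    and u v :: "nat \<Rightarrow> real \<Rightarrow> real \<Rightarrow> real"
  assumes "0 < \<alpha>" and "\<alpha> < 1" and "0 < T" and "1 \<le> k" and "1 \<le> m"
    and "a 1 = 1" and "\<forall>j\<in>{2..k+m}. a j \<noteq> 0"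
    and "B \<in> carrier_mat m k"
    and "neg_definite_mat k (transpose_mat B * B - 1\<^sub>m k)"
    and "\<forall>j\<in>{1..k}. L j < 0" and "\<forall>j\<in>{k+1..k+m}. L j > 0"
    and "star_airy_solution \<alpha> T k m a B L f u0 \<phi>0 \<phi>1 u"
    and "star_airy_solution \<alpha> T k m a B L f u0 \<phi>0 \<phi>1 v"
  shows "\<forall>j\<in>{1..k+m}. \<forall>x\<in>closure (bond k L j). \<forall>t\<in>{0..T}. u j x t = v j x t"
proof -

  \<comment> \<open>The bonds as intervals and the difference of two solutions\<close>
  define J where "J = {1..k+m}"
  define l h where "l j = (if j \<le> k then L j else 0)" and "h j = (if j \<le> k then 0 else L j)" for j
  \<comment> \<open>Incoming bonds carry a condition on the x-derivative at the far end, outgoing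
    ones only at the vertex.\<close>
  define R where "R j = (if j \<le> k then {l j..h j} else insert 0 {l j<..<h j})" for j
  define c where "c = 1 / Gamma (1 - \<alpha>)"
  define w where "w j x t = u j x t - v j x t" for j x t
  define w1 where "w1 j x t = dx {l j..h j} (u j) x t - dx {l j..h j} (v j) x t" for j x t
  define w2 where "w2 j x t = dx {l j..h j} (dx {l j..h j} (u j)) x t
    - dx {l j..h j} (dx {l j..h j} (v j)) x t" for j x t
  have J: "finite J" "1 \<in> J"
    using \<open>1 \<le> k\<close> by (auto simp: J_def)
  have lh: "l j < h j" "l j = 0 \<or> h j = 0" if "j \<in> J" for j
    using that assms(10,11) by (auto simp: J_def l_def h_def)
  have bond: "bond k L j = {l j<..<h j}" for j
    by (simp add: bond_def l_def h_def)
  have closure_bond: "closure {l j<..<h j} = {l j..h j}" if "j \<in> J" for j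
    using lh[OF that] by (simp add: closure_greaterThanLessThan)
  have zero_in: "0 \<in> {l j..h j}" "L j \<in> {l j..h j}" "0 \<in> R j" if "j \<in> J" for j
    using lh[OF that] by (auto simp: l_def h_def R_def split: if_splits)
  \<comment> \<open>Open bonds are nonempty, so their closures are the intervals [l, h]; the
    conditions are restated with these for both solutions.\<close>
  have sol: "\<forall>j\<in>J. classical_on \<alpha> T {l j<..<h j} {l j..h j} (R j) (insert 0 {l j<..<h j}) (y j)"
    "\<forall>j\<in>J. \<forall>x\<in>{l j<..<h j}. \<forall>t\<in>{0<..T}.
       caputo \<alpha> (y j x) t - dx {l j..h j} (dx {l j..h j} (dx {l j..h j} (y j))) x t = f j x t"
    "\<forall>j\<in>J. \<forall>x\<in>{l j..h j}. y j x 0 = u0 j x"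
    "\<forall>t\<in>{0<..T}. \<forall>j\<in>{2..k+m}. a j * y j 0 t = y 1 0 t"
    "\<forall>t\<in>{0<..T}. Matrix.vec m (\<lambda>i. dx {l (k + Suc i)..h (k + Suc i)} (y (k + Suc i)) 0 t)
       = B *\<^sub>v Matrix.vec k (\<lambda>i. dx {l (Suc i)..h (Suc i)} (y (Suc i)) 0 t)"
    "\<forall>t\<in>{0<..T}. (\<Sum>j=1..k. 1 / a j * dx {l j..h j} (dx {l j..h j} (y j)) 0 t)
       = (\<Sum>i=k+1..k+m. 1 / a i * dx {l i..h i} (dx {l i..h i} (y i)) 0 t)"
    "\<forall>t\<in>{0<..T}. \<forall>j\<in>J. y j (L j) t = \<phi>0 j t"
    "\<forall>t\<in>{0<..T}. \<forall>j\<in>{1..k}. dx {l j..h j} (y j) (L j) t = \<phi>1 j t"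
    if y: "star_airy_solution \<alpha> T k m a B L f u0 \<phi>0 \<phi>1 y" for y
  proof -
    note y' = y[unfolded star_airy_solution_def Let_def bond, folded J_def]
    have cl: "closure {l j<..<h j} = {l j..h j}" if "1 \<le> j" "j \<le> k + m" for j
      using that closure_bond by (simp add: J_def)
    show "\<forall>j\<in>J. classical_on \<alpha> T {l j<..<h j} {l j..h j} (R j) (insert 0 {l j<..<h j}) (y j)"
      "\<forall>j\<in>J. \<forall>x\<in>{l j<..<h j}. \<forall>t\<in>{0<..T}.
         caputo \<alpha> (y j x) t - dx {l j..h j} (dx {l j..h j} (dx {l j..h j} (y j))) x t = f j x t"
      "\<forall>j\<in>J. \<forall>x\<in>{l j..h j}. y j x 0 = u0 j x"
      "\<forall>t\<in>{0<..T}. \<forall>j\<in>{2..k+m}. a j * y j 0 t = y 1 0 t"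
      "\<forall>t\<in>{0<..T}. \<forall>j\<in>J. y j (L j) t = \<phi>0 j t"
      using y' by (simp_all add: closure_bond R_def cong: if_cong)
    show "\<forall>t\<in>{0<..T}. \<forall>j\<in>{1..k}. dx {l j..h j} (y j) (L j) t = \<phi>1 j t"
      using y' by (simp add: cl)
    show "\<forall>t\<in>{0<..T}. (\<Sum>j=1..k. 1 / a j * dx {l j..h j} (dx {l j..h j} (y j)) 0 t)
       = (\<Sum>i=k+1..k+m. 1 / a i * dx {l i..h i} (dx {l i..h i} (y i)) 0 t)"
    proof
      fix t assume t: "t \<in> {0<..T}"
      have eq: "(\<Sum>j\<in>I. 1 / a j * dx (closure {l j<..<h j}) (dx (closure {l j<..<h j}) (y j)) 0 t)
          = (\<Sum>j\<in>I. 1 / a j * dx {l j..h j} (dx {l j..h j} (y j)) 0 t)" if "I \<subseteq> J" for I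
        using that by (intro sum.cong refl) (simp add: closure_bond subset_iff)
      have "{1..k} \<subseteq> J" "{k+1..k+m} \<subseteq> J"
        by (auto simp: J_def)
      note eqs = this[THEN eq]
      show "(\<Sum>j=1..k. 1 / a j * dx {l j..h j} (dx {l j..h j} (y j)) 0 t)
          = (\<Sum>i=k+1..k+m. 1 / a i * dx {l i..h i} (dx {l i..h i} (y i)) 0 t)"
        using y' t unfolding eqs[symmetric] by blast
    qed
    \<comment> \<open>The vectors need to agree only at indices below the dimension, and for those
      the shifted bond number lies between 1 and k + m.\<close>
    have "Matrix.vec m (\<lambda>i. dx (closure {l (k + Suc i)<..<h (k + Suc i)}) (y (k + Suc i)) 0 t)
        = Matrix.vec m (\<lambda>i. dx {l (k + Suc i)..h (k + Suc i)} (y (k + Suc i)) 0 t)"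
      "Matrix.vec k (\<lambda>i. dx (closure {l (Suc i)<..<h (Suc i)}) (y (Suc i)) 0 t)
        = Matrix.vec k (\<lambda>i. dx {l (Suc i)..h (Suc i)} (y (Suc i)) 0 t)" for t
      by (auto simp: cl)
    then show "\<forall>t\<in>{0<..T}. Matrix.vec m (\<lambda>i. dx {l (k + Suc i)..h (k + Suc i)} (y (k + Suc i)) 0 t)
       = B *\<^sub>v Matrix.vec k (\<lambda>i. dx {l (Suc i)..h (Suc i)} (y (Suc i)) 0 t)"
      using y' by simp
  qed
  note su = sol[OF assms(12)] and sv = sol[OF assms(13)]
  define G where "G j x t = w j x (max 0 (min T t))" for j x t
  have bonds: "airy_bond \<alpha> T (l j) (h j) (G j) c (w1 j) (w2 j) (\<lambda>x t. deriv (u j x) t - deriv (v j x) t) (R j)"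
    if j: "j \<in> J" for j
    unfolding c_def G_def[abs_def] w_def w1_def[abs_def] w2_def[abs_def]
  proof (rule airy_bond_difference)
    show "insert 0 {l j<..<h j} \<subseteq> R j" "R j \<subseteq> {l j..h j}"
      using zero_in[OF j] lh[OF j] by (auto simp: R_def)
    show "classical_on \<alpha> T {l j<..<h j} {l j..h j} (R j) (insert 0 {l j<..<h j}) (u j)"
      "classical_on \<alpha> T {l j<..<h j} {l j..h j} (R j) (insert 0 {l j<..<h j}) (v j)"
      using su(1) sv(1) j by blast+
    show "u j x 0 = v j x 0" if "x \<in> {l j..h j}" for x
      using bspec[OF bspec[OF su(3) j] that] bspec[OF bspec[OF sv(3) j] that] by simp
    show "caputo \<alpha> (u j x) t - dx {l j..h j} (dx {l j..h j} (dx {l j..h j} (u j))) x t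
        = caputo \<alpha> (v j x) t - dx {l j..h j} (dx {l j..h j} (dx {l j..h j} (v j))) x t"
      if "x \<in> {l j<..<h j}" "t \<in> {0<..T}" for x t
      using bspec[OF bspec[OF bspec[OF su(2) j] that(1)] that(2)]
        bspec[OF bspec[OF bspec[OF sv(2) j] that(1)] that(2)] by simp
  qed (fact assms(1-3) lh[OF j])+
  note causal = airy_bond.axioms(1)[OF bonds]
  define P where "P j = causal.prim (G j)" for j
  define K where "K j = causal.conv \<alpha> T (G j) 0" for j
  have G_eq: "G j x t = w j x t" if "t \<in> {0..T}" for j x t
    using that by (simp add: G_def)
  have P_eq: "P j x t = integral {0..t} (w j x)" if "j \<in> J" "t \<in> {0..T}" for j x t
    unfolding P_def causal.prim_def[OF causal[OF that(1)]]
    using that by (intro integral_cong G_eq) auto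
  have w_init: "w j x 0 = 0" if "j \<in> J" "x \<in> {l j..h j}" for j x
    using su(3) sv(3) that by (simp add: w_def)

  \<comment> \<open>Homogeneous vertex and boundary conditions of the difference\<close>
  have vertex0: "a j * w j 0 t = w 1 0 t" if "j \<in> J" "t \<in> {0..T}" for j t
  proof (cases "t = 0 \<or> j = 1")
    case True
    then show ?thesis
      using w_init[OF that(1) zero_in(1)] w_init[OF J(2) zero_in(1)] that(1) J(2) \<open>a 1 = 1\<close> by auto
  next
    case False
    then have "t \<in> {0<..T}" "j \<in> {2..k+m}"
      using that by (auto simp: J_def)
    then show ?thesis
      using su(4) sv(4) by (simp add: w_def right_diff_distrib)
  qed
  have end0: "w j (L j) t = 0" if "j \<in> J" "t \<in> {0..T}" for j t
  proof (cases "t = 0")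
    case True
    then show ?thesis
      using w_init[OF that(1) zero_in(2)[OF that(1)]] by simp
  next
    case False
    then show ?thesis
      using su(7) sv(7) that by (simp add: w_def)
  qed
  have vertex1: "w1 (k + Suc i) 0 t = (\<Sum>n<k. B $$ (i, n) * w1 (Suc n) 0 t)"
    if i: "i < m" and t: "t \<in> {0<..T}" for i t
  proof -
    have mult: "vec_index (B *\<^sub>v Matrix.vec k g) i = (\<Sum>n<k. B $$ (i, n) * g n)" for g
      using \<open>B \<in> carrier_mat m k\<close> i by (simp add: scalar_prod_def atLeast0LessThan)
    show ?thesis
      using arg_cong[OF bspec[OF su(5) t], of "\<lambda>z. vec_index z i"]
        arg_cong[OF bspec[OF sv(5) t], of "\<lambda>z. vec_index z i"] i
      unfolding mult by (simp add: w1_def right_diff_distrib sum_subtractf)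
  qed
  have vertex2: "(\<Sum>j=1..k. w2 j 0 t / a j) = (\<Sum>i=k+1..k+m. w2 i 0 t / a i)"
    if t: "t \<in> {0<..T}" for t
    using bspec[OF su(6) t] bspec[OF sv(6) t]
    by (simp add: w2_def diff_divide_distrib sum_subtractf)
  have end1: "w1 j (L j) t = 0" if "j \<in> {1..k}" "t \<in> {0<..T}" for j t
    using su(8) sv(8) that by (simp add: w1_def)

  \<comment> \<open>Sign of the boundary terms\<close>
  have dissip: "(\<Sum>j\<in>J. integral {l j..h j} (\<lambda>x. P j x t * K j x t)) \<le> 0" if t: "t \<in> {0<..<T}" for t
  proof -
    have ev: "\<forall>\<^sub>F s in at_right 0. s \<in> {0<..<t}"
      using t by (intro eventually_at_rightI[of 0 t]) auto
    \<comment> \<open>Names the conclusion of \<open>regularity\<close>, so that both derivatives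
      can be chosen for all bonds at once.\<close>
    define reg where "reg j V1 V2 \<longleftrightarrow>
        (\<forall>x\<in>{l j..h j}. ((\<lambda>x. P j x t) has_real_derivative V1 x) (at x within {l j..h j})) \<and>
        (\<forall>x\<in>{l j..h j}. (V1 has_real_derivative V2 x) (at x within {l j..h j})) \<and>
        (\<forall>x\<in>{l j..h j}. (V2 has_real_derivative c * K j x t) (at x within {l j..h j})) \<and>
        (\<forall>x\<in>R j. ((\<lambda>s. integral {s..t} (w1 j x)) \<longlongrightarrow> V1 x) (at_right 0)) \<and>
        ((\<lambda>s. integral {s..t} (w2 j 0)) \<longlongrightarrow> V2 0) (at_right 0)" for j V1 V2
    have "\<forall>j\<in>J. \<exists>V. reg j (fst V) (snd V)"
    proof
      fix j assume j: "j \<in> J"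
      from airy_bond.regularity[OF bonds[OF j] t, folded P_def K_def]
      obtain V1 V2 where "reg j V1 V2"
        unfolding reg_def[symmetric] by (elim exE)
      then show "\<exists>V. reg j (fst V) (snd V)"
        by (intro exI[of _ "(V1, V2)"]) simp
    qed
    from bchoice[OF this] obtain V where V: "\<forall>j\<in>J. reg j (fst (V j)) (snd (V j))" ..
    define W1 W2 where "W1 j = fst (V j)" and "W2 j = snd (V j)" for j
    have reg: "reg j (W1 j) (W2 j)" if "j \<in> J" for j
      using V that by (simp add: W1_def W2_def)
    note W1_lim = reg[unfolded reg_def, THEN conjunct2, THEN conjunct2, THEN conjunct2, THEN conjunct1, rule_format]
      and W2_lim = reg[unfolded reg_def, THEN conjunct2, THEN conjunct2, THEN conjunct2, THEN conjunct2]
    have w1_int: "w1 j 0 integrable_on {s..t}" if "j \<in> J" "s \<in> {0<..<t}" for j s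
      using that t zero_in(3)[OF that(1)]
      by (intro integrable_continuous_interval continuous_on_compose_pair[OF airy_bond.w1_cont[OF bonds[OF that(1)]]]
          continuous_intros) auto
    have w2_int: "w2 j 0 integrable_on {s..t}" if "j \<in> J" "s \<in> {0<..<t}" for j s
      using that t
      by (intro integrable_continuous_interval continuous_on_compose_pair[OF airy_bond.w2_cont[OF bonds[OF that(1)]]]
          continuous_intros) auto
    have P_vertex: "P j 0 t = P 1 0 t / a j" "a j \<noteq> 0" if j: "j \<in> J" for j
    proof -
      have "a j * P j 0 t = integral {0..t} (\<lambda>r. a j * w j 0 r)"
        using P_eq[OF j] t by simp
      also have "\<dots> = integral {0..t} (w 1 0)"
        using t by (intro integral_cong vertex0 j) auto
      also have "\<dots> = P 1 0 t"
        using P_eq[OF J(2)] t by simp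
      finally have *: "a j * P j 0 t = P 1 0 t" .
      show "a j \<noteq> 0"
        using j assms(6,7) by (cases "j = 1") (auto simp: J_def)
      then show "P j 0 t = P 1 0 t / a j"
        using * by (simp add: field_simps)
    qed
    have P_end: "P j (L j) t = 0" if j: "j \<in> J" for j
    proof -
      have "integral {0..t} (w j (L j)) = 0"
        using t by (intro integral_unique has_integral_is_0) (auto intro!: end0 j)
      then show ?thesis
        using P_eq[OF j] t by simp
    qed
    \<comment> \<open>On incoming bonds \<open>L j\<close> belongs to \<open>R j\<close>, so
      \<open>W1 j (L j)\<close> is a limit of time integrals of the boundary value, all of them
      0.\<close>
    have W1_end: "W1 j (L j) = 0" if j: "j \<in> {1..k}" for j
    proof -
      have jJ: "j \<in> J" "L j \<in> R j"
        using j zero_in(2)[of j] by (auto simp: J_def R_def)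
      have "\<forall>\<^sub>F s in at_right 0. integral {s..t} (w1 j (L j)) = 0"
        using ev
      proof eventually_elim
        case (elim s)
        then show ?case
          using t by (intro integral_unique has_integral_is_0) (auto intro!: end1 j)
      qed
      then have "((\<lambda>s. integral {s..t} (w1 j (L j))) \<longlongrightarrow> 0) (at_right 0)"
        by (rule tendsto_eventually)
      with W1_lim[OF jJ] show ?thesis
        by (intro tendsto_unique[of "at_right 0"]) auto
    qed
    \<comment> \<open>The condition is linear, so it passes to the integrals over [s, t] and from
      there to the limit s \<rightarrow> 0.\<close>
    have W1_vertex: "W1 (k + Suc i) 0 = (\<Sum>n<k. B $$ (i, n) * W1 (Suc n) 0)" if i: "i < m" for i
    proof -
      have J': "k + Suc i \<in> J" "\<And>n. n < k \<Longrightarrow> Suc n \<in> J"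
        using i by (auto simp: J_def)
      have "\<forall>\<^sub>F s in at_right 0. integral {s..t} (w1 (k + Suc i) 0)
          = (\<Sum>n<k. B $$ (i, n) * integral {s..t} (w1 (Suc n) 0))"
        using ev
      proof eventually_elim
        case (elim s)
        have "integral {s..t} (w1 (k + Suc i) 0) = integral {s..t} (\<lambda>r. \<Sum>n<k. B $$ (i, n) * w1 (Suc n) 0 r)"
          using elim t by (intro integral_cong vertex1 i) auto
        also have "\<dots> = (\<Sum>n<k. integral {s..t} (\<lambda>r. B $$ (i, n) * w1 (Suc n) 0 r))"
          using elim by (intro integral_sum integrable_on_mult_right w1_int J') auto
        finally show ?case
          by simp
      qed
      moreover have "((\<lambda>s. \<Sum>n<k. B $$ (i, n) * integral {s..t} (w1 (Suc n) 0)) \<longlongrightarrow>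
          (\<Sum>n<k. B $$ (i, n) * W1 (Suc n) 0)) (at_right 0)"
        by (intro tendsto_sum tendsto_mult_left W1_lim J' zero_in(3)) auto
      ultimately have "((\<lambda>s. integral {s..t} (w1 (k + Suc i) 0)) \<longlongrightarrow>
          (\<Sum>n<k. B $$ (i, n) * W1 (Suc n) 0)) (at_right 0)"
        by (simp add: tendsto_cong)
      with W1_lim[OF J'(1) zero_in(3)[OF J'(1)]] show ?thesis
        by (intro tendsto_unique[of "at_right 0"]) auto
    qed
    have W2_vertex: "(\<Sum>j=1..k. W2 j 0 / a j) = (\<Sum>i=k+1..k+m. W2 i 0 / a i)"
    proof -
      have J': "j \<in> {1..k} \<Longrightarrow> j \<in> J" "j \<in> {k+1..k+m} \<Longrightarrow> j \<in> J" for j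
        by (auto simp: J_def)
      have "\<forall>\<^sub>F s in at_right 0. (\<Sum>j=1..k. integral {s..t} (w2 j 0) / a j)
          = (\<Sum>i=k+1..k+m. integral {s..t} (w2 i 0) / a i)"
        using ev
      proof eventually_elim
        case (elim s)
        have "(\<Sum>j\<in>I. integral {s..t} (w2 j 0) / a j) = integral {s..t} (\<lambda>r. \<Sum>j\<in>I. w2 j 0 r / a j)"
          if "finite I" "I \<subseteq> J" for I
          using that elim by (subst integral_sum) (auto intro!: integrable_on_divide w2_int)
        moreover have "integral {s..t} (\<lambda>r. \<Sum>j=1..k. w2 j 0 r / a j) = integral {s..t} (\<lambda>r. \<Sum>j=k+1..k+m. w2 j 0 r / a j)"
          using elim t by (intro integral_cong vertex2) auto
        ultimately show ?case
          using J' by (simp add: subset_iff)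
      qed
      moreover have "((\<lambda>s. \<Sum>j=1..k. integral {s..t} (w2 j 0) / a j) \<longlongrightarrow> (\<Sum>j=1..k. W2 j 0 / a j)) (at_right 0)"
        using J' P_vertex(2) by (intro tendsto_sum tendsto_divide W2_lim tendsto_const) auto
      ultimately have "((\<lambda>s. \<Sum>i=k+1..k+m. integral {s..t} (w2 i 0) / a i) \<longlongrightarrow> (\<Sum>j=1..k. W2 j 0 / a j)) (at_right 0)"
        by (simp add: tendsto_cong)
      moreover have "((\<lambda>s. \<Sum>i=k+1..k+m. integral {s..t} (w2 i 0) / a i) \<longlongrightarrow> (\<Sum>i=k+1..k+m. W2 i 0 / a i)) (at_right 0)"
        using J' P_vertex(2) by (intro tendsto_sum tendsto_divide W2_lim tendsto_const) auto
      ultimately show ?thesis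
        by (intro tendsto_unique[of "at_right 0"]) auto
    qed
    have flux: "integral {l j..h j} (\<lambda>x. P j x t * (c * K j x t))
        = (P j (h j) t * W2 j (h j) - (W1 j (h j))\<^sup>2 / 2) - (P j (l j) t * W2 j (l j) - (W1 j (l j))\<^sup>2 / 2)"
      if "j \<in> J" for j
      using reg[OF that] lh(1)[OF that] unfolding reg_def
      by (intro integral_by_energy[where ?W0.0 = "\<lambda>x. P j x t"]) auto
    \<comment> \<open>The vertex is the upper end, and both terms at the lower end vanish by the two
      boundary conditions there.\<close>
    have flux_in: "integral {l j..h j} (\<lambda>x. P j x t * (c * K j x t))
        = P 1 0 t * (W2 j 0 / a j) - (W1 j 0)\<^sup>2 / 2" if j: "j \<in> {1..k}" for j
    proof -
      have jJ: "j \<in> J" and "l j = L j" "h j = 0"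
        using j by (auto simp: J_def l_def h_def)
      then show ?thesis
        using flux[OF jJ] P_end[OF jJ] W1_end[OF j] P_vertex(1)[OF jJ] by simp
    qed
    \<comment> \<open>The vertex is the lower end. At the far end the primitive vanishes, and the
      term with minus the square of \<open>W1 j (L j)\<close> is dropped, whence the
      inequality.\<close>
    have flux_out: "integral {l j..h j} (\<lambda>x. P j x t * (c * K j x t))
        \<le> (W1 j 0)\<^sup>2 / 2 - P 1 0 t * (W2 j 0 / a j)" if j: "j \<in> {k+1..k+m}" for j
    proof -
      have jJ: "j \<in> J" and "l j = 0" "h j = L j"
        using j by (auto simp: J_def l_def h_def)
      then show ?thesis
        using flux[OF jJ] P_end[OF jJ] P_vertex(1)[OF jJ] by simp
    qed
    have shift: "(\<Sum>i=n+1..n+p. g i) = (\<Sum>i<p. g (n + Suc i))" for n p :: nat and g :: "nat \<Rightarrow> real"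
      by (rule sum.reindex_bij_witness[of _ "\<lambda>i. n + Suc i" "\<lambda>i. i - Suc n"]) auto
    let ?p = "Matrix.vec k (\<lambda>i. W1 (Suc i) 0)"
    have "vec_index (B *\<^sub>v ?p) i = W1 (k + Suc i) 0" if "i < m" for i
      using W1_vertex[OF that] \<open>B \<in> carrier_mat m k\<close> that by (simp add: scalar_prod_def atLeast0LessThan)
    then have quad: "(\<Sum>i=k+1..k+m. (W1 i 0)\<^sup>2) \<le> (\<Sum>i=1..k. (W1 i 0)\<^sup>2)"
      using contraction_of_neg_definite[OF assms(8,9), of ?p] shift[of "\<lambda>i. (W1 i 0)\<^sup>2" k m]
        shift[of "\<lambda>i. (W1 i 0)\<^sup>2" 0 k] by simp
    have "c * (\<Sum>j\<in>J. integral {l j..h j} (\<lambda>x. P j x t * K j x t))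
        = (\<Sum>j\<in>J. integral {l j..h j} (\<lambda>x. P j x t * (c * K j x t)))"
      by (simp add: sum_distrib_left mult.left_commute)
    also have "\<dots> = (\<Sum>j=1..k. integral {l j..h j} (\<lambda>x. P j x t * (c * K j x t)))
        + (\<Sum>j=k+1..k+m. integral {l j..h j} (\<lambda>x. P j x t * (c * K j x t)))"
      unfolding J_def by (rule sum.ub_add_nat) simp
    also have "\<dots> \<le> (\<Sum>j=1..k. P 1 0 t * (W2 j 0 / a j) - (W1 j 0)\<^sup>2 / 2)
        + (\<Sum>j=k+1..k+m. (W1 j 0)\<^sup>2 / 2 - P 1 0 t * (W2 j 0 / a j))"
      by (intro add_mono sum_mono flux_out eq_refl[OF flux_in])
    \<comment> \<open>The first bracket vanishes by the condition on second derivatives; the second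
      is nonpositive because B does not increase length.\<close>
    also have "\<dots> = P 1 0 t * ((\<Sum>j=1..k. W2 j 0 / a j) - (\<Sum>j=k+1..k+m. W2 j 0 / a j))
        + ((\<Sum>j=k+1..k+m. (W1 j 0)\<^sup>2) - (\<Sum>j=1..k. (W1 j 0)\<^sup>2)) / 2"
      by (simp add: sum_subtractf right_diff_distrib diff_divide_distrib sum_distrib_left sum_divide_distrib)
    also have "\<dots> \<le> 0"
      using quad W2_vertex by simp
    finally have "c * (\<Sum>j\<in>J. integral {l j..h j} (\<lambda>x. P j x t * K j x t)) \<le> 0" .
    moreover have "0 < c"
      using \<open>\<alpha> < 1\<close> by (simp add: c_def Gamma_real_pos)
    ultimately show ?thesis
      by (simp add: mult_le_0_iff)
  qed

  \<comment> \<open>Conclusion, including the final time\<close>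
  have w_zero: "w j x t = 0" if j: "j \<in> J" and x: "x \<in> {l j..h j}" and t: "t \<in> {0..<T}" for j x t
  proof -
    have "G j x t = 0"
      by (rule energy_uniqueness[OF J(1) assms(3,1,2) causal dissip[unfolded P_def K_def] j x t])
    then show ?thesis
      using G_eq t by simp
  qed
  show ?thesis
  proof (intro ballI)
    fix j x t
    assume "j \<in> {1..k+m}" and x: "x \<in> closure (bond k L j)" and t: "t \<in> {0..T}"
    then have j: "j \<in> J" and x: "x \<in> {l j..h j}"
      using closure_bond by (auto simp: J_def bond)
    have "w j x t = 0"
    \<comment> \<open>The energy argument stops short of T; continuity in time on [0, T] adds the
      endpoint.\<close>
    proof (rule continuous_on_eq_on_dense[of "{0..T}" "w j x" "\<lambda>_. 0" "{0..<T}"])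
      have "continuous_on {0..T} (G j x)"
        using x by (intro causal.continuous_on_g[OF causal[OF j]] continuous_intros) auto
      then show "continuous_on {0..T} (w j x)"
        by (rule continuous_on_eq) (rule G_eq)
    qed (use w_zero[OF j x] t \<open>0 < T\<close> in \<open>auto simp: closure_atLeastLessThan\<close>)
    then show "u j x t = v j x t"
      by (simp add: w_def)
  qed
qed

end
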